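(* (i) For all integers $k \geq 3$ and $1 \leq a, b \leq k-2$ with $a + b \geq k-1$, the graph $E_{k,a,b}$ is robustly critical. (ii) If $G$ is a robustly critical graph, then $G \vee K_t$ is robustly critical for any $t \in \mathbb{N}$.
   Context: All graphs are finite and simple. For an integer $k \geq 1$, a graph $G$ is $k$-critical if $\chi(G) = k$ and $\chi(G') < k$ for every proper subgraph $G'$ of $G$. The join $G \vee H$ of graphs $G$ and $H$ is obtained from vertex-disjoint copies of $G$ and $H$ by making every vertex of $G$ adjacent to every vertex of $H$. $K_t$ is the complete graph on $t$ vertices. The graph $E_{k,a,b}$: for integers $k \geq 3$ and $1 \leq a, b \leq k-2$ with $a+b \geq k-1$, let $X_1, X_2, Y_1, Y_2$ be disjoint sets with $|X_1| = a$, $|Y_1| = b$, $|X_2| = k-1-a$, $|Y_2| = k-1-b$, and let $z$ be an additional vertex. The vertex set of $E_{k,a,b}$ is $X_1 \cup X_2 \cup Y_1 \cup Y_2 \cup \{z\}$. The sets $X = X_1 \cup X_2$ and $Y = Y_1 \cup Y_2$ are cliques, the neighborhood of $z$ is $X_1 \cup Y_1$, and a vertex $x \in X$ is adjacent to $y \in Y$ if and only if $x \in X_2$ and $y \in Y_2$. A cover of a graph $G$ is a pair $\mathcal{H} = (L,H)$, where $H$ is a graph and $L$ is a function assigning to each $v \in V(G)$ a subset $L(v) \subseteq V(H)$ such that: the sets $L(v)$, $v \in V(G)$, are pairwise disjoint, independent in $H$, and have union $V(H)$; and whenever (for distinct $u,v\in V(G)$) the set $E_H(L(u),L(v))$ of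 edges of $H$ between $L(u)$ and $L(v)$ is nonempty, then $uv \in E(G)$ and $E_H(L(u),L(v))$ is a matching (not necessarily perfect). A proper $\mathcal{H}$-coloring of $G$ is an independent set $T$ of $H$ containing exactly one vertex from each $L(v)$; $G$ is $\mathcal{H}$-colorable if one exists, and otherwise $\mathcal{H}$ is a bad cover of $G$. A cover is $q$-fold if $|L(v)| = q$ for all $v \in V(G)$ (with $q = 0$ allowed). A $q$-fold cover $\mathcal{H} = (L,H)$ of $G$ is canonical if there is a mapping $\lambda \colon V(H) \to [q]$, where $[q]=\{1,\ldots,q\}$, such that for each $v \in V(G)$ the restriction $\lambda|_{L(v)}$ is a bijection from $L(v)$ to $[q]$, and for all $uv \in E(G)$, $c \in L(u)$, $c' \in L(v)$, we have $cc' \in E(H)$ if and only if $\lambda(c) = \lambda(c')$. (In particular the $0$-fold cover is canonical.) For $k \geq 1$, a graph $G$ is robustly $k$-critical if it is $k$-critical and every bad $(k-1)$-fold cover of $G$ is canonical. $G$ is robustly critical if it is robustly $k$-critical for some $k \geq 1$. *)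

theory Defs
  imports Main "HOL-Library.Disjoint_Sets"
begin

section \<open>Finite simple graphs\<close>

datatype 'a graph = Graph (verts: "'a set") (edges: "'a set set")

definition simple_graph :: "'a graph \<Rightarrow> bool" where
  "simple_graph G \<longleftrightarrow> finite (verts G) \<and> (\<forall>e \<in> edges G. e \<subseteq> verts G \<and> card e = 2)"

definition subgraph :: "'a graph \<Rightarrow> 'a graph \<Rightarrow> bool" where
  "subgraph G' G \<longleftrightarrow> simple_graph G' \<and> verts G' \<subseteq> verts G \<and> edges G' \<subseteq> edges G"

definition independent_in :: "'a graph \<Rightarrow> 'a set \<Rightarrow> bool" where
  "independent_in G S \<longleftrightarrow> S \<subseteq> verts G \<and> (\<forall>u \<in> S. \<forall>v \<in> S. {u, v} \<notin> edges G)"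

definition proper_coloring :: "'a graph \<Rightarrow> nat \<Rightarrow> ('a \<Rightarrow> nat) \<Rightarrow> bool" where
  "proper_coloring G n f \<longleftrightarrow>
     f ` verts G \<subseteq> {1..n} \<and> (\<forall>u v. {u, v} \<in> edges G \<longrightarrow> f u \<noteq> f v)"

definition chromatic_number :: "'a graph \<Rightarrow> nat" where
  "chromatic_number G = (LEAST n. \<exists>f. proper_coloring G n f)"

definition critical :: "nat \<Rightarrow> 'a graph \<Rightarrow> bool" where
  "critical k G \<longleftrightarrow> simple_graph G \<and> chromatic_number G = k \<and>
     (\<forall>G'. subgraph G' G \<and> G' \<noteq> G \<longrightarrow> chromatic_number G' < k)"

definition join :: "'a graph \<Rightarrow> 'b graph \<Rightarrow> ('a + 'b) graph" where
  "join G H = Graph (verts G <+> verts H)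
     ((`) Inl ` edges G \<union> (`) Inr ` edges H \<union>
      {{Inl u, Inr v} | u v. u \<in> verts G \<and> v \<in> verts H})"

definition complete_graph :: "nat \<Rightarrow> nat graph" where
  "complete_graph t = Graph {1..t} {{i, j} | i j. i \<in> {1..t} \<and> j \<in> {1..t} \<and> i \<noteq> j}"


section \<open>The graphs \<open>E\<^sub>k\<^sub>,\<^sub>a\<^sub>,\<^sub>b\<close>\<close>

definition E_graph :: "'a set \<Rightarrow> 'a set \<Rightarrow> 'a set \<Rightarrow> 'a set \<Rightarrow> 'a \<Rightarrow> 'a graph" where
  "E_graph X1 X2 Y1 Y2 z = Graph (X1 \<union> X2 \<union> Y1 \<union> Y2 \<union> {z})
     ({{x, x'} | x x'. x \<in> X1 \<union> X2 \<and> x' \<in> X1 \<union> X2 \<and> x \<noteq> x'} \<union>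
      {{y, y'} | y y'. y \<in> Y1 \<union> Y2 \<and> y' \<in> Y1 \<union> Y2 \<and> y \<noteq> y'} \<union>
      {{z, w} | w. w \<in> X1 \<union> Y1} \<union>
      {{x, y} | x y. x \<in> X2 \<and> y \<in> Y2})"

text \<open>
  \<open>is_E_graph k a b G\<close> says that \<open>G\<close> is \<open>E\<^sub>k\<^sub>,\<^sub>a\<^sub>,\<^sub>b\<close> for some choice of the
  underlying sets, which are only determined up to their sizes.  The truncated subtractions are
  harmless in the intended range \<open>k \<ge> 3\<close>, \<open>a, b \<le> k - 2\<close>, where all four sets are nonempty.
\<close>

definition is_E_graph :: "nat \<Rightarrow> nat \<Rightarrow> nat \<Rightarrow> 'a graph \<Rightarrow> bool" where
  "is_E_graph k a b G \<longleftrightarrow>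
     (\<exists>X1 X2 Y1 Y2 z.
        finite X1 \<and> finite X2 \<and> finite Y1 \<and> finite Y2 \<and>
        X1 \<inter> X2 = {} \<and> X1 \<inter> Y1 = {} \<and> X1 \<inter> Y2 = {} \<and>
        X2 \<inter> Y1 = {} \<and> X2 \<inter> Y2 = {} \<and> Y1 \<inter> Y2 = {} \<and>
        z \<notin> X1 \<union> X2 \<union> Y1 \<union> Y2 \<and>
        card X1 = a \<and> card Y1 = b \<and> card X2 = k - 1 - a \<and> card Y2 = k - 1 - b \<and>
        G = E_graph X1 X2 Y1 Y2 z)"

lemma is_E_graph_exists:
  assumes "k \<ge> 3" "1 \<le> a" "a \<le> k - 2" "1 \<le> b" "b \<le> k - 2"
  shows "\<exists>G :: nat graph. is_E_graph k a b G"
proof -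
  have "is_E_graph k a b (E_graph {1..a} {a+1..k-1} {k..k+b-1} {k+b..2*k-2} 0)"
    unfolding is_E_graph_def
    by (rule exI[of _ "{1..a}"], rule exI[of _ "{a+1..k-1}"], rule exI[of _ "{k..k+b-1}"],
        rule exI[of _ "{k+b..2*k-2}"], rule exI[of _ 0]) (use assms in auto)
  then show ?thesis by blast
qed


section \<open>Covers\<close>

definition edges_between :: "'c graph \<Rightarrow> 'c set \<Rightarrow> 'c set \<Rightarrow> 'c set set" where
  "edges_between H A B = {{x, y} | x y. x \<in> A \<and> y \<in> B \<and> {x, y} \<in> edges H}"

text \<open>A cover is given by \<open>L\<close> and \<open>H\<close>; the values of \<open>L\<close> outside \<open>verts G\<close> play no role.\<close>

definition cover :: "'a graph \<Rightarrow> ('a \<Rightarrow> 'c set) \<Rightarrow> 'c graph \<Rightarrow> bool" where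
  "cover G L H \<longleftrightarrow> simple_graph H \<and>
     disjoint_family_on L (verts G) \<and>
     (\<forall>v \<in> verts G. independent_in H (L v)) \<and>
     (\<Union>v \<in> verts G. L v) = verts H \<and>
     (\<forall>u \<in> verts G. \<forall>v \<in> verts G. u \<noteq> v \<and> edges_between H (L u) (L v) \<noteq> {} \<longrightarrow>
        {u, v} \<in> edges G \<and> disjoint (edges_between H (L u) (L v)))"

definition cover_coloring :: "'a graph \<Rightarrow> ('a \<Rightarrow> 'c set) \<Rightarrow> 'c graph \<Rightarrow> 'c set \<Rightarrow> bool" where
  "cover_coloring G L H T \<longleftrightarrow> independent_in H T \<and> (\<forall>v \<in> verts G. \<exists>!x. x \<in> T \<inter> L v)"

definition bad_cover :: "'a graph \<Rightarrow> ('a \<Rightarrow> 'c set) \<Rightarrow> 'c graph \<Rightarrow> bool" where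
  "bad_cover G L H \<longleftrightarrow> cover G L H \<and> \<not> (\<exists>T. cover_coloring G L H T)"

definition fold_cover :: "nat \<Rightarrow> 'a graph \<Rightarrow> ('a \<Rightarrow> 'c set) \<Rightarrow> 'c graph \<Rightarrow> bool" where
  "fold_cover q G L H \<longleftrightarrow> cover G L H \<and> (\<forall>v \<in> verts G. card (L v) = q)"

definition canonical_cover :: "nat \<Rightarrow> 'a graph \<Rightarrow> ('a \<Rightarrow> 'c set) \<Rightarrow> 'c graph \<Rightarrow> bool" where
  "canonical_cover q G L H \<longleftrightarrow> fold_cover q G L H \<and>
     (\<exists>lam :: 'c \<Rightarrow> nat.
        (\<forall>v \<in> verts G. bij_betw lam (L v) {1..q}) \<and>
        (\<forall>u v. {u, v} \<in> edges G \<longrightarrow>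
           (\<forall>c \<in> L u. \<forall>c' \<in> L v. {c, c'} \<in> edges H \<longleftrightarrow> lam c = lam c')))"

text \<open>
  A definition cannot quantify over types, so the covers below live on natural numbers.
  Cover graphs are finite, so this is no restriction; see
  \<open>robustly_k_critical_canonical\<close> below.
\<close>

definition robustly_k_critical :: "nat \<Rightarrow> 'a graph \<Rightarrow> bool" where
  "robustly_k_critical k G \<longleftrightarrow> k \<ge> 1 \<and> critical k G \<and>
     (\<forall>(L :: 'a \<Rightarrow> nat set) H.
        fold_cover (k - 1) G L H \<and> bad_cover G L H \<longrightarrow> canonical_cover (k - 1) G L H)"

definition robustly_critical :: "'a graph \<Rightarrow> bool" where
  "robustly_critical G \<longleftrightarrow> (\<exists>k \<ge> 1. robustly_k_critical k G)"


section \<open>Independence of the vertex type of covers\<close>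

definition map_graph :: "('c \<Rightarrow> 'd) \<Rightarrow> 'c graph \<Rightarrow> 'd graph" where
  "map_graph f H = Graph (f ` verts H) ((`) f ` edges H)"

lemma map_graph_edge_iff:
  assumes "simple_graph H" "inj_on f (verts H)" "x \<in> verts H" "y \<in> verts H"
  shows "{f x, f y} \<in> edges (map_graph f H) \<longleftrightarrow> {x, y} \<in> edges H"
proof
  assume "{f x, f y} \<in> edges (map_graph f H)"
  then obtain e where e: "e \<in> edges H" "f ` {x, y} = f ` e"
    by (auto simp: map_graph_def)
  then have "e \<subseteq> verts H" using assms(1) by (auto simp: simple_graph_def)
  with e assms have "{x, y} = e"
    using inj_on_image_eq_iff[of f "verts H" "{x, y}" e] by auto
  with e show "{x, y} \<in> edges H" by simp
next
  assume "{x, y} \<in> edges H"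
  then have "f ` {x, y} \<in> (`) f ` edges H" by (rule imageI)
  then show "{f x, f y} \<in> edges (map_graph f H)" by (simp add: map_graph_def)
qed

lemma simple_graph_map_graph:
  assumes "simple_graph H" "inj_on f (verts H)"
  shows "simple_graph (map_graph f H)"
  unfolding simple_graph_def
proof (intro conjI ballI)
  show "finite (verts (map_graph f H))"
    using assms by (simp add: simple_graph_def map_graph_def)
  fix e assume "e \<in> edges (map_graph f H)"
  then obtain d where d: "d \<in> edges H" "e = f ` d" by (auto simp: map_graph_def)
  then have "d \<subseteq> verts H" "card d = 2" using assms(1) by (auto simp: simple_graph_def)
  then show "e \<subseteq> verts (map_graph f H)" "card e = 2"
    using d assms(2) by (auto simp: map_graph_def card_image inj_on_subset)
qed

lemma cover_part_subset: "cover G L H \<Longrightarrow> v \<in> verts G \<Longrightarrow> L v \<subseteq> verts H"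
  by (auto simp: cover_def)

lemma cover_map_graph:
  assumes c: "cover G L H" and inj: "inj_on f (verts H)"
  shows "cover G (\<lambda>v. f ` L v) (map_graph f H)"
proof -
  have H: "simple_graph H" using c by (simp add: cover_def)
  have sub: "L v \<subseteq> verts H" if "v \<in> verts G" for v
    using c that by (rule cover_part_subset)
  have eb: "edges_between (map_graph f H) (f ` L u) (f ` L v)
      = (`) f ` edges_between H (L u) (L v)" if "u \<in> verts G" "v \<in> verts G" for u v
  proof -
    have iff: "{f x, f y} \<in> edges (map_graph f H) \<longleftrightarrow> {x, y} \<in> edges H"
      if "x \<in> L u" "y \<in> L v" for x y
      using map_graph_edge_iff[OF H inj] that sub \<open>u \<in> verts G\<close> \<open>v \<in> verts G\<close> by blast
    show ?thesis
    proof (intro equalityI subsetI)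
      fix e assume "e \<in> edges_between (map_graph f H) (f ` L u) (f ` L v)"
      then obtain x y where "x \<in> L u" "y \<in> L v" "e = f ` {x, y}" "{x, y} \<in> edges H"
        using iff by (auto simp: edges_between_def)
      then show "e \<in> (`) f ` edges_between H (L u) (L v)"
        unfolding edges_between_def by blast
    next
      fix e assume "e \<in> (`) f ` edges_between H (L u) (L v)"
      then obtain x y where "x \<in> L u" "y \<in> L v" "e = {f x, f y}" "{x, y} \<in> edges H"
        by (auto simp: edges_between_def)
      then show "e \<in> edges_between (map_graph f H) (f ` L u) (f ` L v)"
        using iff unfolding edges_between_def by blast
    qed
  qed
  show ?thesis
    unfolding cover_def
  proof (intro conjI ballI impI)
    show "simple_graph (map_graph f H)" by (rule simple_graph_map_graph[OF H inj])
    show "disjoint_family_on (\<lambda>v. f ` L v) (verts G)"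
      unfolding disjoint_family_on_def
    proof (intro ballI impI)
      fix u v assume uv: "u \<in> verts G" "v \<in> verts G" "u \<noteq> v"
      then have "L u \<inter> L v = {}" using c by (auto simp: cover_def disjoint_family_on_def)
      then show "f ` L u \<inter> f ` L v = {}"
        using inj_on_image_Int[OF inj sub sub] uv by (metis image_empty)
    qed
    show "(\<Union>v \<in> verts G. f ` L v) = verts (map_graph f H)"
    proof -
      have "(\<Union>v \<in> verts G. f ` L v) = f ` (\<Union>v \<in> verts G. L v)" by blast
      also have "\<dots> = f ` verts H" using c by (simp add: cover_def)
      finally show ?thesis by (simp add: map_graph_def)
    qed
  next
    fix v assume v: "v \<in> verts G"
    then have "independent_in H (L v)" using c by (simp add: cover_def)
    then show "independent_in (map_graph f H) (f ` L v)"
      using map_graph_edge_iff[OF H inj] sub[OF v]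
      by (auto simp: independent_in_def map_graph_def subset_iff)
  next
    fix u v assume uv: "u \<in> verts G" "v \<in> verts G"
      and ne: "u \<noteq> v \<and> edges_between (map_graph f H) (f ` L u) (f ` L v) \<noteq> {}"
    then have *: "{u, v} \<in> edges G" "disjoint (edges_between H (L u) (L v))"
      using c eb[OF uv] by (auto simp: cover_def)
    then show "{u, v} \<in> edges G" by simp
    have "\<Union> (edges_between H (L u) (L v)) \<subseteq> verts H"
      using sub uv by (auto simp: edges_between_def)
    then show "disjoint (edges_between (map_graph f H) (f ` L u) (f ` L v))"
      unfolding eb[OF uv] using *(2) inj
      by (intro disjoint_image) (auto intro: inj_on_subset)
  qed
qed

proposition robustly_k_critical_canonical:
  fixes L :: "'a \<Rightarrow> 'c set"
  assumes "robustly_k_critical k G" and q: "fold_cover (k - 1) G L H" and bad: "bad_cover G L H"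
  shows "canonical_cover (k - 1) G L H"
proof -
  have c: "cover G L H" using bad by (simp add: bad_cover_def)
  then have H: "simple_graph H" by (simp add: cover_def)
  then have "finite (verts H)" by (simp add: simple_graph_def)
  then obtain f :: "'c \<Rightarrow> nat" where inj: "inj_on f (verts H)"
    using finite_imp_inj_to_nat_seg by blast
  have G: "simple_graph G"
    using assms(1) by (simp add: robustly_k_critical_def critical_def)
  have sub: "L v \<subseteq> verts H" if "v \<in> verts G" for v
    using c that by (rule cover_part_subset)
  let ?L = "\<lambda>v. f ` L v" and ?H = "map_graph f H"
  have c': "cover G ?L ?H" by (rule cover_map_graph[OF c inj])
  have q': "fold_cover (k - 1) G ?L ?H"
    using q c' sub inj by (auto simp: fold_cover_def card_image inj_on_subset)
  have "\<not> cover_coloring G ?L ?H T" for T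
  proof
    assume T: "cover_coloring G ?L ?H T"
    define S where "S = {x \<in> verts H. f x \<in> T}"
    have "independent_in H S"
      unfolding independent_in_def
    proof (intro conjI ballI)
      show "S \<subseteq> verts H" by (auto simp: S_def)
      fix x y assume "x \<in> S" "y \<in> S"
      moreover from this have "{f x, f y} \<notin> edges ?H"
        using T by (auto simp: S_def cover_coloring_def independent_in_def)
      ultimately show "{x, y} \<notin> edges H"
        using map_graph_edge_iff[OF H inj] by (auto simp: S_def)
    qed
    moreover have "\<exists>!x. x \<in> S \<inter> L v" if v: "v \<in> verts G" for v
    proof -
      have "\<exists>!y. y \<in> T \<inter> f ` L v" using T v by (auto simp: cover_coloring_def)
      then obtain x where x: "x \<in> L v" "f x \<in> T" and uniq: "\<And>y. y \<in> T \<inter> f ` L v \<Longrightarrow> y = f x"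
        by (metis IntE IntI imageE)
      show ?thesis
      proof (rule ex1I)
        show "x \<in> S \<inter> L v" using x sub[OF v] by (auto simp: S_def)
        fix y assume "y \<in> S \<inter> L v"
        then have "y \<in> verts H" "f y = f x" using uniq by (auto simp: S_def)
        then show "y = x" using inj_onD[OF inj] x sub[OF v] by blast
      qed
    qed
    ultimately have "cover_coloring G L H S" by (simp add: cover_coloring_def)
    then show False using bad by (auto simp: bad_cover_def)
  qed
  then have "bad_cover G ?L ?H" using c' by (simp add: bad_cover_def)
  then have "canonical_cover (k - 1) G ?L ?H"
    using assms(1) q' by (simp add: robustly_k_critical_def)
  then obtain lam :: "nat \<Rightarrow> nat" where
    lam: "\<forall>v \<in> verts G. bij_betw lam (f ` L v) {1..k - 1}"
      "\<forall>u v. {u, v} \<in> edges G \<longrightarrow> (\<forall>c \<in> f ` L u. \<forall>c' \<in> f ` L v.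
         {c, c'} \<in> edges ?H \<longleftrightarrow> lam c = lam c')"
    unfolding canonical_cover_def by blast
  have iff: "{f x, f y} \<in> edges ?H \<longleftrightarrow> lam (f x) = lam (f y)"
    if "{u, v} \<in> edges G" "x \<in> L u" "y \<in> L v" for u v x y
    using lam(2) that by blast
  have "bij_betw (lam \<circ> f) (L v) {1..k - 1}" if "v \<in> verts G" for v
    using bspec[OF lam(1) that] sub[OF that] inj
    by (meson bij_betw_trans inj_on_imp_bij_betw inj_on_subset)
  moreover have "{x, y} \<in> edges H \<longleftrightarrow> (lam \<circ> f) x = (lam \<circ> f) y"
    if uv: "{u, v} \<in> edges G" and xy: "x \<in> L u" "y \<in> L v" for u v x y
  proof -
    have "u \<in> verts G" "v \<in> verts G" using G uv by (auto simp: simple_graph_def)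
    then have "x \<in> verts H" "y \<in> verts H" using sub xy by auto
    then show ?thesis using iff[OF uv xy] map_graph_edge_iff[OF H inj] by simp
  qed
  ultimately show ?thesis
    using q unfolding canonical_cover_def by blast
qed

end

theory Submission
  imports Defs "HOL-Library.Nat_Bijection"
begin

text \<open>
  A graph with a vertex, without isolated vertices, that is not \<open>(k - 1)\<close>-colourable is
  \<open>k\<close>-critical as soon as all its bad \<open>(k - 1)\<close>-fold covers are canonical, because leaving one
  edge of a canonical cover unmatched gives a non-canonical cover.  So only bad covers matter.

  For the join, colour the new vertex by \<open>x\<close> and delete the neighbours of \<open>x\<close>: what is left is a
  bad cover of the old graph, hence perfectly matched along every edge.  Comparing different \<open>x\<close>
  shows that the matchings to the new vertex label the whole cover.

  In a bad \<open>m\<close>-fold cover of \<open>E\<^sub>k\<^sub>,\<^sub>a\<^sub>,\<^sub>b\<close>, \<open>m = k - 1\<close>, a colouring \<open>f\<close> of \<open>X2\<close> blocks those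
  colours of \<open>z\<close> for which it does not extend to \<open>X1\<close>.  A greedy argument shows that at most
  \<open>a\<close> colours are blocked; every other colour of \<open>z\<close> is blocked from the \<open>Y\<close> side by each
  compatible colouring of \<open>Y2\<close>, and counting in a list of \<open>Y1\<close> shows that exactly \<open>a\<close> are
  blocked and that all the matchings involved are perfect.  The matchings to \<open>z\<close> then label the
  cover consistently.
\<close>

section \<open>Greedy colouring from matched lists\<close>

text \<open>The vertices of \<open>X2\<close> are not adjacent to \<open>z\<close>, so a colour at
  \<open>X2\<close> gets a label in \<open>L z\<close> only by a detour: over some \<open>x\<close>
  in \<open>X1\<close>, or over \<open>v\<close> in \<open>Y2\<close> and then \<open>y\<close> in
  \<open>Y1\<close>. That all detours give the same label is the main obstacle. It is overcome
  without tracing single colours: for every colouring of \<open>X2\<close>, each detour sends the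
  colours used onto the colours of \<open>z\<close> that are not blocked, and two labellings with
  the same image on every colouring coincide. The assumption a + b \<ge> k - 1 says that
  \<open>Y2\<close> has at most as many vertices as \<open>X1\<close>. This is what lets a colouring
  of \<open>X2\<close> be extended greedily to a compatible colouring of \<open>Y2\<close> with one
  colour prescribed. Greedy colouring is stated for sublists \<open>M\<close> and a bare relation
  \<open>R\<close>, because it is applied to lists already shortened by earlier choices, while the
  matchings stay those of the full lists \<open>L\<close>.\<close>

locale matching_family =
  fixes V :: "'a set" and L :: "'a \<Rightarrow> 'c set" and R :: "'c \<Rightarrow> 'c \<Rightarrow> bool"
  assumes finite_V: "finite V"
    and finite_L: "v \<in> V \<Longrightarrow> finite (L v)"
    and R_sym: "R c d \<Longrightarrow> R d c"
    and R_matching: "\<lbrakk>u \<in> V; v \<in> V; u \<noteq> v; c \<in> L u; d \<in> L v; d' \<in> L v; R c d; R c d'\<rbrakk> \<Longrightarrow> d = d'"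
begin

definition col :: "'a set \<Rightarrow> ('a \<Rightarrow> 'c set) \<Rightarrow> ('a \<Rightarrow> 'c) \<Rightarrow> bool" where
  "col S M f \<longleftrightarrow> (\<forall>v\<in>S. f v \<in> M v) \<and> (\<forall>u\<in>S. \<forall>v\<in>S. u \<noteq> v \<longrightarrow> \<not> R (f u) (f v))"

definition avail :: "'a set \<Rightarrow> ('a \<Rightarrow> 'c) \<Rightarrow> ('a \<Rightarrow> 'c set) \<Rightarrow> 'a \<Rightarrow> 'c set" where
  "avail S f M v = {d \<in> M v. \<forall>u\<in>S. \<not> R (f u) d}"

lemma col_cong: "(\<And>v. v \<in> S \<Longrightarrow> f v = g v) \<Longrightarrow> col S M f \<longleftrightarrow> col S M g"
  by (simp add: col_def)

lemma avail_subset: "avail S f M v \<subseteq> M v"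
  by (auto simp: avail_def)

text \<open>A coloured vertex has at most one partner in \<open>L v\<close>, so it costs
  \<open>v\<close> at most one colour; \<open>THE\<close> names this partner and turns the removed
  colours into a subset of an image of \<open>S\<close>.\<close>

lemma card_avail:
  assumes "S \<subseteq> V" "v \<in> V" "v \<notin> S" "M v \<subseteq> L v" "\<And>u. u \<in> S \<Longrightarrow> f u \<in> L u"
  shows "card (M v) \<le> card (avail S f M v) + card S"
proof -
  have finS: "finite S" using assms(1) finite_V finite_subset by blast
  have finM: "finite (M v)" using assms(2,4) finite_L finite_subset by blast
  let ?B = "{d \<in> M v. \<exists>u\<in>S. R (f u) d}"
  have "?B \<subseteq> (\<lambda>u. THE d. d \<in> L v \<and> R (f u) d) ` S"
  proof
    fix d assume "d \<in> ?B"
    then obtain u where u: "u \<in> S" "R (f u) d" "d \<in> L v" using assms(4) by blast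
    then have "(THE d. d \<in> L v \<and> R (f u) d) = d"
      using R_matching[of u v "f u"] assms by (intro the_equality) blast+
    then show "d \<in> (\<lambda>u. THE d. d \<in> L v \<and> R (f u) d) ` S" using u(1) by force
  qed
  then have "card ?B \<le> card S"
    using finS by (meson card_image_le card_mono finite_imageI le_trans)
  moreover have "M v = avail S f M v \<union> ?B" by (auto simp: avail_def)
  then have "card (M v) \<le> card (avail S f M v) + card ?B"
    by (metis card_Un_le)
  ultimately show ?thesis by linarith
qed

lemma card_avail1:
  assumes "u \<in> V" "v \<in> V" "u \<noteq> v" "M v \<subseteq> L v" "c \<in> L u"
  shows "card (M v) \<le> Suc (card (avail {u} (\<lambda>_. c) M v))"
  using card_avail[of "{u}" v M "\<lambda>_. c"] assms by auto

lemma col_insert: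
  assumes "col S M f" "v \<notin> S" "d \<in> M v" "\<And>u. u \<in> S \<Longrightarrow> \<not> R (f u) d"
  shows "col (insert v S) M (f(v := d))"
proof -
  have "\<not> R d (f u)" if "u \<in> S" for u using assms(4)[OF that] R_sym by blast
  then show ?thesis using assms unfolding col_def by auto
qed

lemma greedy:
  assumes "S \<subseteq> V" "\<And>v. v \<in> S \<Longrightarrow> M v \<subseteq> L v" "\<And>v. v \<in> S \<Longrightarrow> card S \<le> card (M v)"
  shows "\<exists>f. col S M f"
proof -
  have "finite S" using assms(1) finite_V finite_subset by blast
  then show ?thesis using assms
  proof (induction S rule: finite_induct)
    case empty
    then show ?case by (auto simp: col_def)
  next
    case (insert v S)
    have "card S \<le> card (M u)" if "u \<in> S" for u
      using insert.prems(3)[of u] insert.hyps that by auto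
    then obtain f where f: "col S M f" using insert by auto
    have "\<And>u. u \<in> S \<Longrightarrow> f u \<in> L u" using f insert.prems(2) by (auto simp: col_def)
    then have "card (M v) \<le> card (avail S f M v) + card S"
      using insert by (intro card_avail) auto
    moreover have "Suc (card S) \<le> card (M v)" using insert.prems(3)[of v] insert.hyps by auto
    ultimately have "avail S f M v \<noteq> {}" by auto
    then obtain d where "d \<in> avail S f M v" by blast
    then show ?case using col_insert[OF f] insert.hyps by (auto simp: avail_def)
  qed
qed

text \<open>Giving \<open>p\<close> to \<open>u\<close> costs every other list at most one colour,
  and one vertex fewer remains to be coloured.\<close>

lemma greedy_extend:
  assumes S: "S \<subseteq> V" "\<And>v. v \<in> S \<Longrightarrow> M v \<subseteq> L v" "\<And>v. v \<in> S \<Longrightarrow> card S \<le> card (M v)"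
    and u: "u \<in> S" and p: "p \<in> M u"
  shows "\<exists>f. col S M f \<and> f u = p"
proof -
  have finS: "finite S" using S(1) finite_V finite_subset by blast
  then have cS: "card S = Suc (card (S - {u}))" using u by (metis card_Suc_Diff1)
  let ?M = "avail {u} (\<lambda>_. p) M"
  have "card (M w) \<le> Suc (card (?M w))" if "w \<in> S - {u}" for w
    using that S u p by (intro card_avail1) auto
  then have "card (S - {u}) \<le> card (?M w)" if "w \<in> S - {u}" for w
    using S(3)[of w] cS that by (metis DiffD1 Suc_le_mono le_trans)
  then have "\<exists>f. col (S - {u}) ?M f"
    using S avail_subset by (intro greedy) blast+
  then obtain f where f: "col (S - {u}) ?M f" by blast
  then have "col (S - {u}) M f" by (auto simp: col_def avail_def)
  moreover have "\<not> R (f w) p" if "w \<in> S - {u}" for w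
    using f that R_sym[of "f w" p] by (auto simp: col_def avail_def)
  ultimately have "col (insert u (S - {u})) M (f(u := p))"
    using p by (intro col_insert) auto
  then show ?thesis using u by (intro exI[of _ "f(u := p)"]) (simp add: insert_absorb)
qed

text \<open>After the lists have been shortened by \<open>p\<close>, the colour \<open>p'\<close> is
  still present because it is not matched to \<open>p\<close>; so it can be prescribed in
  turn.\<close>

lemma greedy_extend2:
  assumes S: "S \<subseteq> V" "\<And>v. v \<in> S \<Longrightarrow> M v \<subseteq> L v" "\<And>v. v \<in> S \<Longrightarrow> card S \<le> card (M v)"
    and u: "u \<in> S" "u' \<in> S" "u \<noteq> u'" and p: "p \<in> M u" "p' \<in> M u'" "\<not> R p p'"
  shows "\<exists>f. col S M f \<and> f u = p \<and> f u' = p'"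
proof -
  have finS: "finite S" using S(1) finite_V finite_subset by blast
  then have cS: "card S = Suc (card (S - {u}))" using u by (metis card_Suc_Diff1)
  let ?M = "avail {u} (\<lambda>_. p) M"
  have "card (M w) \<le> Suc (card (?M w))" if "w \<in> S - {u}" for w
    using that S u p by (intro card_avail1) auto
  then have "card (S - {u}) \<le> card (?M w)" if "w \<in> S - {u}" for w
    using S(3)[of w] cS that by (metis DiffD1 Suc_le_mono le_trans)
  then have "\<exists>f. col (S - {u}) ?M f \<and> f u' = p'"
    using S avail_subset u p by (intro greedy_extend) (auto simp: avail_def)
  then obtain f where f: "col (S - {u}) ?M f" "f u' = p'" by blast
  then have "col (S - {u}) M f" by (auto simp: col_def avail_def)
  moreover have "\<not> R (f w) p" if "w \<in> S - {u}" for w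
    using f that R_sym[of "f w" p] by (auto simp: col_def avail_def)
  ultimately have "col (insert u (S - {u})) M (f(u := p))"
    using p by (intro col_insert) auto
  then show ?thesis using u f(2)
    by (intro exI[of _ "f(u := p)"]) (auto simp add: insert_absorb)
qed

text \<open>The vertex \<open>v0\<close> with the longer list is coloured last: the others are one
  fewer, which their lists can afford.\<close>

lemma greedy_slack:
  assumes S: "S \<subseteq> V" and M: "\<And>v. v \<in> S \<Longrightarrow> M v \<subseteq> L v"
    and c: "\<And>v. v \<in> S \<Longrightarrow> card S \<le> Suc (card (M v))"
    and v0: "v0 \<in> S" "card S \<le> card (M v0)"
  shows "\<exists>f. col S M f"
proof -
  have finS: "finite S" using S finite_V finite_subset by blast
  then have cS: "card S = Suc (card (S - {v0}))" using v0 by (metis card_Suc_Diff1)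
  have "card (S - {v0}) \<le> card (M v)" if "v \<in> S - {v0}" for v
    using c[of v] that cS by (metis DiffD1 Suc_le_mono)
  then have "\<exists>f. col (S - {v0}) M f"
    using S M by (intro greedy) auto
  then obtain f where f: "col (S - {v0}) M f" by blast
  have "card (M v0) \<le> card (avail (S - {v0}) f M v0) + card (S - {v0})"
    using S M v0 f by (intro card_avail) (auto simp: col_def)
  then have "card (avail (S - {v0}) f M v0) \<noteq> 0" using v0(2) cS by linarith
  then have "avail (S - {v0}) f M v0 \<noteq> {}" by force
  then obtain d where "d \<in> avail (S - {v0}) f M v0" by blast
  then have "col (insert v0 (S - {v0})) M (f(v0 := d))"
    by (intro col_insert[OF f]) (auto simp: avail_def)
  then show ?thesis using v0 by (auto simp: insert_absorb)
qed

lemma clique_tight: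
  assumes "S \<subseteq> V" "\<And>v. v \<in> S \<Longrightarrow> M v \<subseteq> L v" "\<And>v. v \<in> S \<Longrightarrow> card S \<le> Suc (card (M v))"
    and "\<nexists>f. col S M f" "v \<in> S"
  shows "card S = Suc (card (M v))"
  using greedy_slack[of S M v] assms by (metis le_SucE le_antisym order_refl)

text \<open>A colour \<open>p\<close> without a partner in \<open>M v\<close> could be given to
  \<open>u\<close> without shortening \<open>M v\<close>; then \<open>v\<close> provides the slack
  for a greedy colouring of the rest.\<close>

lemma clique_perfect:
  assumes S: "S \<subseteq> V" and M: "\<And>v. v \<in> S \<Longrightarrow> M v \<subseteq> L v"
    and c: "\<And>v. v \<in> S \<Longrightarrow> card S \<le> Suc (card (M v))"
    and no: "\<nexists>f. col S M f" and uv: "u \<in> S" "v \<in> S" "u \<noteq> v" and p: "p \<in> M u"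
  shows "\<exists>d\<in>M v. R p d"
proof (rule ccontr)
  assume neg: "\<not> (\<exists>d\<in>M v. R p d)"
  let ?M = "avail {u} (\<lambda>_. p) M"
  have finS: "finite S" using S finite_V finite_subset by blast
  then have cS: "card S = Suc (card (S - {u}))" using uv by (metis card_Suc_Diff1)
  have Mv: "?M v = M v" using neg by (auto simp: avail_def)
  have "card (M w) \<le> Suc (card (?M w))" if "w \<in> S - {u}" for w
    using that S M uv p by (intro card_avail1) auto
  then have "card (S - {u}) \<le> Suc (card (?M w))" if "w \<in> S - {u}" for w
    using c[of w] cS that by (metis DiffD1 Suc_le_mono le_trans)
  moreover have "card (S - {u}) \<le> card (?M v)" using c[OF uv(2)] cS Mv by (metis Suc_le_mono)
  moreover have "?M w \<subseteq> L w" if "w \<in> S - {u}" for w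
    using that M avail_subset by blast
  ultimately have "\<exists>f. col (S - {u}) ?M f"
    using S uv by (intro greedy_slack[of _ _ v]) auto
  then obtain f where f: "col (S - {u}) ?M f" by blast
  then have "col (S - {u}) M f" "\<And>w. w \<in> S - {u} \<Longrightarrow> \<not> R (f w) p"
    using R_sym by (auto simp: col_def avail_def)
  then have "col (insert u (S - {u})) M (f(u := p))"
    using p by (intro col_insert) auto
  then show False using no uv by (auto simp: insert_absorb)
qed

section \<open>Perfect matchings between lists, and comparison of labellings\<close>

definition perf :: "'a \<Rightarrow> 'a \<Rightarrow> bool" where
  "perf u v \<longleftrightarrow> (\<forall>c\<in>L u. \<exists>d\<in>L v. R c d)"

text \<open>The source list is not an argument: for a colour in the list of another vertex, the
  partner in \<open>L v\<close> is unique if it exists, and otherwise the value is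
  arbitrary.\<close>

definition nb :: "'a \<Rightarrow> 'c \<Rightarrow> 'c" where
  "nb v c = (SOME d. d \<in> L v \<and> R c d)"

lemma nb_ex:
  assumes "\<exists>d\<in>L v. R c d"
  shows "nb v c \<in> L v" "R c (nb v c)"
proof -
  have "nb v c \<in> L v \<and> R c (nb v c)"
    unfolding nb_def by (rule someI_ex) (use assms in blast)
  then show "nb v c \<in> L v" "R c (nb v c)" by blast+
qed

lemma nb_in: "perf u v \<Longrightarrow> c \<in> L u \<Longrightarrow> nb v c \<in> L v"
  and nb_R: "perf u v \<Longrightarrow> c \<in> L u \<Longrightarrow> R c (nb v c)"
  by (simp_all add: nb_ex perf_def)

lemma nb_eq:
  assumes "u \<in> V" "v \<in> V" "u \<noteq> v" "c \<in> L u" "d \<in> L v" "R c d"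
  shows "nb v c = d"
  using R_matching[OF assms(1-4) _ assms(5) _ assms(6)] nb_ex[of v c] assms(5,6) by blast

lemma inj_on_nb:
  assumes uv: "u \<in> V" "v \<in> V" "u \<noteq> v" and A: "A \<subseteq> L u" "\<And>c. c \<in> A \<Longrightarrow> \<exists>d\<in>L v. R c d"
  shows "inj_on (nb v) A"
proof (rule inj_onI)
  fix c d assume c: "c \<in> A" "d \<in> A" and eq: "nb v c = nb v d"
  have "R (nb v c) c" "R (nb v c) d"
    using R_sym[OF nb_ex(2)[OF A(2)[OF c(1)]]] R_sym[OF nb_ex(2)[OF A(2)[OF c(2)]]] eq by simp_all
  then show "c = d"
    using R_matching[OF uv(2,1) _ nb_ex(1)[OF A(2)[OF c(1)]], of c d] uv A(1) c by blast
qed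

lemma inj_nb: "u \<in> V \<Longrightarrow> v \<in> V \<Longrightarrow> u \<noteq> v \<Longrightarrow> perf u v \<Longrightarrow> inj_on (nb v) (L u)"
  by (rule inj_on_nb) (auto simp: perf_def)

lemma bij_nb:
  assumes "u \<in> V" "v \<in> V" "u \<noteq> v" "perf u v" "card (L u) = card (L v)"
  shows "bij_betw (nb v) (L u) (L v)"
proof -
  have "nb v ` L u \<subseteq> L v" using nb_in[OF assms(4)] by auto
  moreover have "card (nb v ` L u) = card (L v)" using card_image[OF inj_nb] assms by metis
  ultimately have "nb v ` L u = L v" using assms finite_L card_subset_eq by metis
  then show ?thesis using inj_nb assms by (auto simp: bij_betw_def)
qed

lemma perf_sym:
  assumes "u \<in> V" "v \<in> V" "u \<noteq> v" "perf u v" "card (L u) = card (L v)"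
  shows "perf v u"
  unfolding perf_def
proof
  fix d assume "d \<in> L v"
  then obtain c where "c \<in> L u" "d = nb v c" using bij_nb[OF assms] by (auto simp: bij_betw_def)
  then show "\<exists>c\<in>L u. R d c" using nb_R[OF assms(4)] R_sym by blast
qed

lemma nb_nb:
  assumes "u \<in> V" "v \<in> V" "u \<noteq> v" "perf u v" "c \<in> L u"
  shows "nb u (nb v c) = c"
  using assms(3) by (intro nb_eq[OF assms(2,1) _ nb_in[OF assms(4,5)] assms(5)
      R_sym[OF nb_R[OF assms(4,5)]]]) simp

text \<open>Replacing a single colour of a transversal changes its label set in one place, which
  recovers the label of that colour.\<close>

lemma labels_agree:
  assumes S: "S \<subseteq> V" and m: "\<And>v. v \<in> S \<Longrightarrow> card S < card (L v)"
    and inj: "inj_on (l1 u) (L u)"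
    and img: "\<And>f. col S L f \<Longrightarrow> (\<lambda>u. l1 u (f u)) ` S = (\<lambda>u. l2 u (f u)) ` S"
    and crd: "\<And>f. col S L f \<Longrightarrow> card ((\<lambda>u. l1 u (f u)) ` S) = card S"
    and u: "u \<in> S" and p: "p \<in> L u"
  shows "l1 u p = l2 u p"
proof -
  have finS: "finite S" using S finite_V finite_subset by blast
  then have cS: "card S = Suc (card (S - {u}))" using u by (metis card_Suc_Diff1)
  obtain f where f0: "col S L f" "f u = p"
    using greedy_extend[of S L u p] S u p m less_imp_le by blast
  then have f: "col (S - {u}) L f" "\<And>w. w \<in> S - {u} \<Longrightarrow> \<not> R (f w) p"
    using u unfolding col_def by blast+
  \<comment> \<open>The rest of \<open>f\<close> excludes at most \<open>card S - 1\<close> of more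
    than \<open>card S\<close> colours, so \<open>u\<close> has a second choice besides
    \<open>p\<close>.\<close>
  have "card (L u) \<le> card (avail (S - {u}) f L u) + card (S - {u})"
    using S u f by (intro card_avail) (auto simp: col_def)
  then have c2: "2 \<le> card (avail (S - {u}) f L u)" using m[OF u] cS by linarith
  have "\<not> avail (S - {u}) f L u \<subseteq> {p}"
  proof
    assume "avail (S - {u}) f L u \<subseteq> {p}"
    then have "card (avail (S - {u}) f L u) \<le> card {p}" by (intro card_mono) auto
    then show False using c2 by simp
  qed
  then obtain p' where p': "p' \<in> L u" "p' \<noteq> p" "\<And>w. w \<in> S - {u} \<Longrightarrow> \<not> R (f w) p'"
    by (auto simp: avail_def)
  have c: "col S L (f(u := q))" if "q \<in> L u" "\<And>w. w \<in> S - {u} \<Longrightarrow> \<not> R (f w) q" for q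
    using col_insert[OF f(1), of u q] that u by (auto simp: insert_absorb)
  let ?T1 = "(\<lambda>w. l1 w (f w)) ` (S - {u})" and ?T2 = "(\<lambda>w. l2 w (f w)) ` (S - {u})"
  have ins: "(\<lambda>w. l w ((f(u := q)) w)) ` S = insert (l u q) ((\<lambda>w. l w (f w)) ` (S - {u}))"
    for l :: "'a \<Rightarrow> 'c \<Rightarrow> 'e" and q
    using u by force
  have e: "insert (l1 u q) ?T1 = insert (l2 u q) ?T2 \<and> l1 u q \<notin> ?T1"
    if "q \<in> L u" "\<And>w. w \<in> S - {u} \<Longrightarrow> \<not> R (f w) q" for q
  proof -
    have "insert (l1 u q) ?T1 = insert (l2 u q) ?T2"
      using img[OF c[OF that]] unfolding ins .
    moreover have inj': "inj_on (\<lambda>w. l1 w ((f(u := q)) w)) S"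
      using crd[OF c[OF that]] finS by (rule eq_card_imp_inj_on[rotated])
    have "l1 u q \<noteq> l1 w (f w)" if "w \<in> S - {u}" for w
      using inj_on_contraD[OF inj', of u w] u that by auto
    then have "l1 u q \<notin> ?T1" by blast
    ultimately show ?thesis by blast
  qed
  \<comment> \<open>If the labels of \<open>p\<close> differed, \<open>l1 u p\<close> would lie in
    \<open>?T2\<close>, hence in \<open>insert (l1 u p') ?T1\<close>; but it is neither in
    \<open>?T1\<close> nor equal to \<open>l1 u p'\<close>.\<close>
  have "l1 u p \<noteq> l1 u p'" using inj p p' by (auto simp: inj_on_def)
  moreover note e[OF p f(2)] e[OF p'(1,3)]
  ultimately show ?thesis by (metis insertCI insertE)
qed

end

section \<open>Covers and criticality\<close>

abbreviation adj :: "'c graph \<Rightarrow> 'c \<Rightarrow> 'c \<Rightarrow> bool" where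
  "adj H c d \<equiv> {c, d} \<in> edges H"

lemma simple_graph_edge:
  assumes "simple_graph G" "{u, v} \<in> edges G"
  shows "u \<in> verts G" "v \<in> verts G" "u \<noteq> v"
  using assms by (fastforce simp: simple_graph_def)+

lemma cover_adj:
  assumes "cover G L H" "u \<in> verts G" "v \<in> verts G" "c \<in> L u" "d \<in> L v" "adj H c d"
  shows "u \<noteq> v" "{u, v} \<in> edges G"
proof -
  show "u \<noteq> v" using assms unfolding cover_def independent_in_def by blast
  moreover have "edges_between H (L u) (L v) \<noteq> {}" using assms by (auto simp: edges_between_def)
  ultimately show "{u, v} \<in> edges G" using assms unfolding cover_def by blast
qed

lemma cover_owner_unique:
  assumes "cover G L H" "u \<in> verts G" "v \<in> verts G" "c \<in> L u" "c \<in> L v"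
  shows "u = v"
proof (rule ccontr)
  assume "u \<noteq> v"
  then have "L u \<inter> L v = {}"
    using assms(1-3) disjoint_family_onD[of L "verts G" u v] by (simp add: cover_def)
  then show False using assms(4,5) by blast
qed

lemma matching_family_cover:
  assumes G: "simple_graph G" and c: "cover G L H"
  shows "matching_family (verts G) L (adj H)"
proof
  show "finite (verts G)" using G by (simp add: simple_graph_def)
  have "finite (verts H)" using c by (simp add: cover_def simple_graph_def)
  then show "finite (L v)" if "v \<in> verts G" for v
    using cover_part_subset[OF c that] finite_subset by blast
  show "adj H d c" if "adj H c d" for c d using that by (simp add: insert_commute)
  fix u v c d d'
  assume uv: "u \<in> verts G" "v \<in> verts G" "u \<noteq> v" and "c \<in> L u" "d \<in> L v" "d' \<in> L v"
    and "adj H c d" "adj H c d'"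
  then have e: "{c, d} \<in> edges_between H (L u) (L v)" "{c, d'} \<in> edges_between H (L u) (L v)"
    unfolding edges_between_def by blast+
  then have "disjoint (edges_between H (L u) (L v))" using c uv unfolding cover_def by blast
  then have "{c, d} = {c, d'}" using disjointD[OF _ e] by blast
  then show "d = d'" by (auto simp: doubleton_eq_iff)
qed

lemma col_imp_cover_coloring:
  assumes c: "cover G L H" and f: "matching_family.col (adj H) (verts G) L f"
    and mf: "matching_family (verts G) L (adj H)"
  shows "cover_coloring G L H (f ` verts G)"
  unfolding cover_coloring_def independent_in_def
proof (intro conjI ballI)
  note f' = f[unfolded matching_family.col_def[OF mf]]
  show "f ` verts G \<subseteq> verts H" using f' cover_part_subset[OF c] by blast
  show "\<not> adj H a b" if "a \<in> f ` verts G" "b \<in> f ` verts G" for a b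
    using that f' cover_adj(1)[OF c] by blast
  show "\<exists>!x. x \<in> f ` verts G \<inter> L v" if v: "v \<in> verts G" for v
  proof (rule ex1I)
    show "f v \<in> f ` verts G \<inter> L v" using v f' by blast
    show "x = f v" if "x \<in> f ` verts G \<inter> L v" for x
      using that f' cover_owner_unique[OF c] v by blast
  qed
qed

lemma cover_coloring_imp_col:
  assumes "cover_coloring G L H T" and mf: "matching_family (verts G) L (adj H)"
  shows "\<exists>f. matching_family.col (adj H) (verts G) L f"
proof -
  have "\<forall>v\<in>verts G. \<exists>x. x \<in> T \<inter> L v" using assms unfolding cover_coloring_def by blast
  then obtain f where "\<forall>v\<in>verts G. f v \<in> T \<inter> L v" by metis
  moreover have "\<And>a b. a \<in> T \<Longrightarrow> b \<in> T \<Longrightarrow> \<not> adj H a b"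
    using assms by (auto simp: cover_coloring_def independent_in_def)
  ultimately show ?thesis
    unfolding matching_family.col_def[OF mf] by blast
qed

text \<open>In the applications the labels are colours from the list of one distinguished vertex and
  are read off differently at each vertex. A single numbering results because every colour has a
  unique owner and \<open>B\<close> can be numbered by \<open>{1..q}\<close>.\<close>

lemma canonical_coverI:
  assumes fold: "fold_cover q G L H" and simple: "simple_graph G"
    and B: "finite B" "card B = q"
    and bij: "\<And>v. v \<in> verts G \<Longrightarrow> bij_betw (lab v) (L v) B"
    and lab: "\<And>u v c d. \<lbrakk>{u, v} \<in> edges G; c \<in> L u; d \<in> L v\<rbrakk> \<Longrightarrow> adj H c d \<longleftrightarrow> lab u c = lab v d"
  shows "canonical_cover q G L H"
proof -
  have c: "cover G L H" using fold by (simp add: fold_cover_def)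
  obtain b where b: "bij_betw b B {1..q}"
    using B finite_same_card_bij[of B "{1..q}"] by auto
  define lam where "lam c = b (lab (THE v. v \<in> verts G \<and> c \<in> L v) c)" for c
  have lam: "lam c = b (lab v c)" if "v \<in> verts G" "c \<in> L v" for v c
  proof -
    have "(THE v. v \<in> verts G \<and> c \<in> L v) = v"
      using that cover_owner_unique[OF c] by blast
    then show ?thesis by (simp add: lam_def)
  qed
  have "bij_betw lam (L v) {1..q}" if v: "v \<in> verts G" for v
  proof -
    have "bij_betw (b \<circ> lab v) (L v) {1..q}" using bij_betw_trans[OF bij[OF v] b] .
    moreover have "bij_betw lam (L v) {1..q} \<longleftrightarrow> bij_betw (b \<circ> lab v) (L v) {1..q}"
      using lam[OF v] by (intro bij_betw_cong) simp
    ultimately show ?thesis by simp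
  qed
  moreover have "adj H c d \<longleftrightarrow> lam c = lam d" if uv: "{u, v} \<in> edges G" and cd: "c \<in> L u" "d \<in> L v"
    for u v c d
  proof -
    have V: "u \<in> verts G" "v \<in> verts G" using simple_graph_edge[OF simple uv] by auto
    have "lab u c \<in> B" "lab v d \<in> B" using bij[OF V(1)] bij[OF V(2)] cd by (auto simp: bij_betw_def)
    then have "lam c = lam d \<longleftrightarrow> lab u c = lab v d"
      using lam[OF V(1) cd(1)] lam[OF V(2) cd(2)] b by (auto simp: bij_betw_def inj_on_def)
    then show ?thesis using lab[OF uv cd] by simp
  qed
  ultimately show ?thesis using fold unfolding canonical_cover_def by blast
qed

section \<open>Colourability and critical graphs\<close>

definition colorable :: "'a graph \<Rightarrow> nat \<Rightarrow> bool" where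
  "colorable G n \<longleftrightarrow> (\<exists>f. proper_coloring G n f)"

lemma colorable_mono: "colorable G n \<Longrightarrow> n \<le> n' \<Longrightarrow> colorable G n'"
  unfolding colorable_def proper_coloring_def
  by (elim ex_forward conj_forward) (auto elim: order_trans)

lemma colorable_subgraph: "colorable G n \<Longrightarrow> subgraph G' G \<Longrightarrow> colorable G' n"
  unfolding colorable_def proper_coloring_def subgraph_def
  by (elim ex_forward conj_forward) (auto elim: image_mono[THEN order_trans])

lemma colorable_chromatic_number:
  assumes "simple_graph G"
  shows "colorable G (chromatic_number G)"
proof -
  obtain g :: "'a \<Rightarrow> nat" where g: "inj_on g (verts G)"
    using assms finite_imp_inj_to_nat_seg[of "verts G"] by (auto simp: simple_graph_def)
  have fin: "finite (verts G)" using assms by (simp add: simple_graph_def)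
  have "Suc (g u) \<noteq> Suc (g v)" if "{u, v} \<in> edges G" for u v
  proof -
    have "u \<in> verts G" "v \<in> verts G" "u \<noteq> v" using simple_graph_edge[OF assms that] by auto
    then show ?thesis using g by (auto simp: inj_on_def)
  qed
  moreover have "(\<lambda>v. Suc (g v)) ` verts G \<subseteq> {1..Suc (Max (g ` verts G))}"
    using fin by auto
  ultimately have "\<exists>f. proper_coloring G (Suc (Max (g ` verts G))) f"
    unfolding proper_coloring_def by (intro exI[of _ "\<lambda>v. Suc (g v)"]) blast
  then show ?thesis unfolding colorable_def chromatic_number_def by (rule LeastI)
qed

lemma chromatic_number_le_iff:
  assumes "simple_graph G"
  shows "chromatic_number G \<le> n \<longleftrightarrow> colorable G n"
proof
  show "colorable G n" if "chromatic_number G \<le> n"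
    using colorable_mono[OF colorable_chromatic_number[OF assms] that] .
  show "chromatic_number G \<le> n" if "colorable G n"
    using that unfolding colorable_def chromatic_number_def by (rule Least_le)
qed

lemma chromatic_number_less_iff:
  "simple_graph G \<Longrightarrow> k \<ge> 1 \<Longrightarrow> chromatic_number G < k \<longleftrightarrow> colorable G (k - 1)"
  using chromatic_number_le_iff[of G "k - 1"] by linarith

lemma critical_not_colorable: "critical k G \<Longrightarrow> k \<ge> 1 \<Longrightarrow> \<not> colorable G (k - 1)"
  using chromatic_number_less_iff[of G k] by (auto simp: critical_def)

definition induced :: "'a graph \<Rightarrow> 'a set \<Rightarrow> 'a graph" where
  "induced G S = Graph S {e \<in> edges G. e \<subseteq> S}"

lemma induced_simps [simp]: "verts (induced G S) = S" "edges (induced G S) = {e \<in> edges G. e \<subseteq> S}"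
  by (simp_all add: induced_def)

lemma simple_graph_induced: "simple_graph G \<Longrightarrow> S \<subseteq> verts G \<Longrightarrow> simple_graph (induced G S)"
  by (auto simp: simple_graph_def intro: finite_subset)

lemma subgraph_induced: "simple_graph G \<Longrightarrow> S \<subseteq> verts G \<Longrightarrow> subgraph (induced G S) G"
  by (auto simp: subgraph_def simple_graph_induced)

lemma critical_del_vertex:
  assumes "critical k G" "k \<ge> 1" "v \<in> verts G"
  shows "colorable (induced G (verts G - {v})) (k - 1)"
proof -
  have s: "simple_graph G" using assms by (simp add: critical_def)
  have sub: "subgraph (induced G (verts G - {v})) G" using s by (intro subgraph_induced) auto
  moreover have "induced G (verts G - {v}) \<noteq> G"
    using assms(3) by (metis DiffD2 induced_simps(1) singletonI)
  ultimately have "chromatic_number (induced G (verts G - {v})) < k"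
    using assms by (auto simp: critical_def)
  then show ?thesis
    using assms(2) sub by (subst (asm) chromatic_number_less_iff) (auto simp: subgraph_def)
qed

lemma not_colorable_nonempty:
  assumes "simple_graph G" "\<not> colorable G n"
  shows "verts G \<noteq> {}"
  using assms simple_graph_edge(1)[OF assms(1)] by (auto simp: colorable_def proper_coloring_def)

lemma critical_no_isolated:
  assumes "critical k G" "k \<ge> 2" "v \<in> verts G"
  shows "\<exists>u. {u, v} \<in> edges G"
proof (rule ccontr)
  assume iso: "\<not> ?thesis"
  have s: "simple_graph G" using assms by (simp add: critical_def)
  obtain f where f: "proper_coloring (induced G (verts G - {v})) (k - 1) f"
    using critical_del_vertex[OF assms(1) _ assms(3)] assms(2) by (auto simp: colorable_def)
  \<comment> \<open>An isolated vertex may take colour 1, which is among the \<open>k - 1\<close>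
    colours since \<open>k \<ge> 2\<close>.\<close>
  have "proper_coloring G (k - 1) (f(v := 1))"
    unfolding proper_coloring_def
  proof (intro conjI allI impI)
    show "(f(v := 1)) ` verts G \<subseteq> {1..k - 1}"
      using f assms(2) by (auto simp: proper_coloring_def)
    fix u w assume uw: "{u, w} \<in> edges G"
    then have ne: "u \<noteq> v" "w \<noteq> v" using iso by (auto simp: insert_commute)
    have "{u, w} \<subseteq> verts G" using simple_graph_edge[OF s uw] by simp
    then have "f u \<noteq> f w" using f uw ne by (auto simp: proper_coloring_def)
    then show "(f(v := 1)) u \<noteq> (f(v := 1)) w" using ne by simp
  qed
  then show False using critical_not_colorable[OF assms(1)] assms(2) by (auto simp: colorable_def)
qed

lemma critical_1:
  assumes "critical 1 G"
  shows "\<exists>v. verts G = {v} \<and> edges G = {}"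
proof -
  have s: "simple_graph G" using assms by (simp add: critical_def)
  have "\<not> colorable G 0" using critical_not_colorable[OF assms] by simp
  then have "verts G \<noteq> {}" by (rule not_colorable_nonempty[OF s])
  then obtain v where v: "v \<in> verts G" by blast
  have "colorable (induced G (verts G - {v})) 0" using critical_del_vertex[OF assms _ v] by simp
  then have V: "verts G = {v}" using v by (auto simp: colorable_def proper_coloring_def)
  have "edges G = {}"
  proof (rule ccontr)
    assume "edges G \<noteq> {}"
    then obtain e where "e \<subseteq> {v}" "card e = 2" using s V by (auto simp: simple_graph_def)
    then show False using card_mono[of "{v}" e] by simp
  qed
  then show ?thesis using V by blast
qed

text \<open>The \<open>q\<close>-fold cover that is canonical except that nothing is matched along the edge \<open>e\<close>;
  its colourings are the proper \<open>q\<close>-colourings of \<open>G - e\<close>.\<close>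

lemma ex_cover_without_edge:
  assumes s: "simple_graph G" and e: "e \<in> edges G" and q: "q \<ge> 1"
  shows "\<exists>(L :: 'a \<Rightarrow> nat set) H. fold_cover q G L H \<and> \<not> canonical_cover q G L H \<and>
    (\<forall>T. cover_coloring G L H T \<longrightarrow> colorable (Graph (verts G) (edges G - {e})) q)"
proof -
  have "finite (verts G)" using s by (simp add: simple_graph_def)
  then obtain g :: "'a \<Rightarrow> nat" where g: "inj_on g (verts G)"
    using finite_imp_inj_to_nat_seg by blast
  have ed: "u \<in> verts G \<and> v \<in> verts G \<and> u \<noteq> v" if "{u, v} \<in> edges G" for u v
    using that simple_graph_edge[OF s] by blast
  define p where "p v i = prod_encode (g v, i)" for v i
  have p_eq: "p u i = p v j \<longleftrightarrow> u = v \<and> i = j" if "u \<in> verts G" "v \<in> verts G" for u v i j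
    using that g by (auto simp: p_def inj_on_def)
  define L where "L v = p v ` {1..q}" for v
  define H where "H = Graph (\<Union>v\<in>verts G. L v)
    {{p u i, p v i} | u v i. {u, v} \<in> edges G - {e} \<and> i \<in> {1..q}}"
  have H_adj: "adj H (p u i) (p v j) \<longleftrightarrow> i = j \<and> {u, v} \<in> edges G - {e} \<and> i \<in> {1..q}"
    if V: "u \<in> verts G" "v \<in> verts G" for u v i j
  proof
    assume "adj H (p u i) (p v j)"
    then obtain u' v' l where l: "{p u i, p v j} = {p u' l, p v' l}" "{u', v'} \<in> edges G - {e}"
      "l \<in> {1..q}" by (auto simp: H_def)
    have V': "u' \<in> verts G" "v' \<in> verts G" using ed l(2) by blast+
    have "(u = u' \<and> i = l \<and> v = v' \<and> j = l) \<or> (u = v' \<and> i = l \<and> v = u' \<and> j = l)"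
      using l(1) unfolding doubleton_eq_iff p_eq[OF V(1) V'(1)] p_eq[OF V(2) V'(2)]
        p_eq[OF V(1) V'(2)] p_eq[OF V(2) V'(1)] by blast
    then show "i = j \<and> {u, v} \<in> edges G - {e} \<and> i \<in> {1..q}"
      using l(2,3) by (metis insert_commute)
  qed (auto simp: H_def)
  have c: "cover G L H"
    unfolding cover_def
  proof (intro conjI ballI impI)
    show "simple_graph H"
      unfolding simple_graph_def
    proof (intro conjI ballI)
      show "finite (verts H)" using \<open>finite (verts G)\<close> by (auto simp: H_def L_def)
      fix d assume "d \<in> edges H"
      then obtain u v i where d: "d = {p u i, p v i}" "{u, v} \<in> edges G" "i \<in> {1..q}"
        by (auto simp: H_def)
      then have V: "u \<in> verts G" "v \<in> verts G" "u \<noteq> v" using ed by auto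
      have "p u i \<in> L u" "p v i \<in> L v" using d(3) by (auto simp: L_def)
      then show "d \<subseteq> verts H" using d(1) V by (auto simp: H_def)
      show "card d = 2" using d(1) V p_eq[OF V(1,2)] by simp
    qed
    show "disjoint_family_on L (verts G)"
      using p_eq by (auto simp: disjoint_family_on_def L_def)
    show "(\<Union>v\<in>verts G. L v) = verts H" by (simp add: H_def)
    show "independent_in H (L v)" if "v \<in> verts G" for v
      unfolding independent_in_def
    proof
      show "L v \<subseteq> verts H" using that by (auto simp: H_def)
      show "\<forall>a\<in>L v. \<forall>b\<in>L v. \<not> adj H a b"
        using H_adj[OF that that] ed[of v v] by (auto simp: L_def)
    qed
    fix u v assume V: "u \<in> verts G" "v \<in> verts G"
      and "u \<noteq> v \<and> edges_between H (L u) (L v) \<noteq> {}"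
    then obtain i j where "adj H (p u i) (p v j)" by (auto simp: edges_between_def L_def)
    then show "{u, v} \<in> edges G" using H_adj[OF V] by blast
    then have "u \<noteq> v" using ed by blast
    show "disjoint (edges_between H (L u) (L v))"
    proof (rule disjointI)
      have *: "\<exists>i. a = {p u i, p v i}" if "a \<in> edges_between H (L u) (L v)" for a
        using that H_adj[OF V] by (auto simp: edges_between_def L_def)
      fix a b assume "a \<in> edges_between H (L u) (L v)" "b \<in> edges_between H (L u) (L v)" "a \<noteq> b"
      then obtain i j where ij: "a = {p u i, p v i}" "b = {p u j, p v j}" "i \<noteq> j" using * by metis
      then show "a \<inter> b = {}" using p_eq V \<open>u \<noteq> v\<close> by auto
    qed
  qed
  have "card (L v) = q" if "v \<in> verts G" for v
    using that p_eq by (auto simp: L_def card_image inj_on_def)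
  then have fold: "fold_cover q G L H" using c by (simp add: fold_cover_def)
  moreover have "\<not> canonical_cover q G L H"
  proof
    assume "canonical_cover q G L H"
    then obtain lam :: "nat \<Rightarrow> nat" where lam: "\<forall>v\<in>verts G. bij_betw lam (L v) {1..q}"
      "\<forall>u v. {u, v} \<in> edges G \<longrightarrow> (\<forall>c\<in>L u. \<forall>c'\<in>L v. adj H c c' \<longleftrightarrow> lam c = lam c')"
      unfolding canonical_cover_def by blast
    have "card e = 2" using s e by (simp add: simple_graph_def)
    then obtain u v where uv: "e = {u, v}" by (meson card_2_iff)
    then have V: "u \<in> verts G" "v \<in> verts G" using ed e by auto
    \<comment> \<open>As \<open>q \<ge> 1\<close>, the label 1 occurs at both ends of
      \<open>e\<close>; a canonical cover would have to join these two colours.\<close>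
    have "1 \<in> lam ` L u" "1 \<in> lam ` L v" using lam(1) V q by (auto simp: bij_betw_def)
    then obtain c d where cd: "c \<in> L u" "d \<in> L v" "lam c = lam d" by (metis imageE)
    then have "adj H c d" using lam(2) e uv by blast
    then show False using cd H_adj[OF V] uv by (auto simp: L_def)
  qed
  moreover have "colorable (Graph (verts G) (edges G - {e})) q" if T: "cover_coloring G L H T" for T
  proof -
    have "\<forall>v\<in>verts G. \<exists>i\<in>{1..q}. p v i \<in> T"
    proof
      fix v assume "v \<in> verts G"
      then obtain x where "x \<in> T \<inter> L v" using T unfolding cover_coloring_def by blast
      then show "\<exists>i\<in>{1..q}. p v i \<in> T" by (auto simp: L_def)
    qed
    then obtain f where f: "\<And>v. v \<in> verts G \<Longrightarrow> f v \<in> {1..q} \<and> p v (f v) \<in> T" by metis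
    have "f u \<noteq> f v" if "{u, v} \<in> edges G - {e}" for u v
    proof
      assume "f u = f v"
      have V: "u \<in> verts G" "v \<in> verts G" using ed[of u v] that by auto
      then have "adj H (p u (f u)) (p v (f v))" using H_adj[OF V] that f \<open>f u = f v\<close> by auto
      then show False using T f V by (auto simp: cover_coloring_def independent_in_def)
    qed
    then have "proper_coloring (Graph (verts G) (edges G - {e})) q f"
      using f by (auto simp: proper_coloring_def)
    then show ?thesis by (auto simp: colorable_def)
  qed
  ultimately show ?thesis by blast
qed

text \<open>Without isolated vertices the edges determine the vertices, so every proper subgraph
  misses an edge, and it is enough to colour the graphs with one edge deleted.\<close>

lemma robustly_k_criticalI:
  assumes s: "simple_graph G" and k: "k \<ge> 2"
    and iso: "\<And>v. v \<in> verts G \<Longrightarrow> \<exists>u. {u, v} \<in> edges G"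
    and nc: "\<not> colorable G (k - 1)"
    and can: "\<And>(L :: 'a \<Rightarrow> nat set) H. fold_cover (k - 1) G L H \<Longrightarrow> bad_cover G L H \<Longrightarrow>
      canonical_cover (k - 1) G L H"
  shows "robustly_k_critical k G"
proof -
  have q: "1 \<le> k - 1" using k by simp
  have del: "colorable (Graph (verts G) (edges G - {e})) (k - 1)" if e: "e \<in> edges G" for e
  proof -
    obtain L :: "'a \<Rightarrow> nat set" and H where LH: "fold_cover (k - 1) G L H"
      "\<not> canonical_cover (k - 1) G L H"
      "\<forall>T. cover_coloring G L H T \<longrightarrow> colorable (Graph (verts G) (edges G - {e})) (k - 1)"
      using ex_cover_without_edge[OF s e q] by blast
    then have "\<not> bad_cover G L H" using can by blast
    then show ?thesis using LH by (auto simp: bad_cover_def fold_cover_def)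
  qed
  have "verts G \<noteq> {}" by (rule not_colorable_nonempty[OF s nc])
  then obtain u v where uv: "{u, v} \<in> edges G" using iso by blast
  have "u \<noteq> v" using simple_graph_edge[OF s uv] by auto
  obtain f where f: "proper_coloring (Graph (verts G) (edges G - {{u, v}})) (k - 1) f"
    using del[OF uv] by (auto simp: colorable_def)
  \<comment> \<open>One end of the deleted edge receives the new colour \<open>k\<close>, which
    bounds the chromatic number from above.\<close>
  have "proper_coloring G k (f(u := k))"
    unfolding proper_coloring_def
  proof (intro conjI allI impI)
    have "f ` verts G \<subseteq> {1..k - 1}" using f by (simp add: proper_coloring_def)
    then have fV: "f x \<in> {1..k - 1}" if "x \<in> verts G" for x using that by blast
    then show "(f(u := k)) ` verts G \<subseteq> {1..k}" using k by (fastforce split: if_splits)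
    fix x y assume xy: "{x, y} \<in> edges G"
    then have V: "x \<in> verts G" "y \<in> verts G" "x \<noteq> y" using simple_graph_edge[OF s xy] by auto
    show "(f(u := k)) x \<noteq> (f(u := k)) y"
    proof (cases "x = u \<or> y = u")
      case True
      then show ?thesis using fV[OF V(1)] fV[OF V(2)] V(3) k by auto
    next
      case False
      then have "{x, y} \<in> edges G - {{u, v}}" using xy by (auto simp: doubleton_eq_iff)
      then show ?thesis using f False by (auto simp: proper_coloring_def)
    qed
  qed
  then have "chromatic_number G \<le> k" using chromatic_number_le_iff[OF s] by (auto simp: colorable_def)
  moreover have "\<not> chromatic_number G < k" using chromatic_number_less_iff[OF s] nc k by simp
  ultimately have "chromatic_number G = k" by simp
  moreover have "chromatic_number G' < k" if G': "subgraph G' G" "G' \<noteq> G" for G'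
  proof -
    have s': "simple_graph G'" using G' by (simp add: subgraph_def)
    have "\<exists>e \<in> edges G. e \<notin> edges G'"
    proof (rule ccontr)
      assume "\<not> ?thesis"
      then have E: "edges G' = edges G" using G' by (auto simp: subgraph_def)
      have "v \<in> verts G'" if "v \<in> verts G" for v
        using iso[OF that] simple_graph_edge(2)[OF s'] unfolding E by blast
      then have "verts G' = verts G" using G' by (auto simp: subgraph_def)
      then show False using E G'(2) by (simp add: graph.expand)
    qed
    then obtain e where e: "e \<in> edges G" "e \<notin> edges G'" by blast
    have "subgraph G' (Graph (verts G) (edges G - {e}))"
      using G' e by (auto simp: subgraph_def)
    then have "colorable G' (k - 1)" using colorable_subgraph[OF del[OF e(1)]] by blast
    then show ?thesis using chromatic_number_less_iff[OF s'] k by simp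
  qed
  ultimately have "critical k G" using s by (auto simp: critical_def)
  then show ?thesis using can k by (auto simp: robustly_k_critical_def)
qed

section \<open>Joins\<close>

text \<open>Shortening the lists at will preserves covers; this makes what is left after deleting
  the neighbours of a chosen colour a cover again.\<close>

lemma cover_induced:
  assumes c: "cover G L H" and S: "S \<subseteq> verts G" and M: "\<And>v. v \<in> S \<Longrightarrow> M v \<subseteq> L v"
  shows "cover (induced G S) M (induced H (\<Union>v\<in>S. M v))" (is "cover ?G M ?H")
proof -
  have sub: "(\<Union>v\<in>S. M v) \<subseteq> verts H"
    using cover_part_subset[OF c] S M by blast
  show ?thesis
    unfolding cover_def
  proof (intro conjI ballI impI)
    show "simple_graph ?H" using c sub by (intro simple_graph_induced) (simp_all add: cover_def)
    show "disjoint_family_on M (verts ?G)"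
      unfolding disjoint_family_on_def
    proof (intro ballI impI)
      fix u v assume "u \<in> verts ?G" "v \<in> verts ?G" "u \<noteq> v"
      then show "M u \<inter> M v = {}" using cover_owner_unique[OF c] S M by fastforce
    qed
    show "(\<Union>v\<in>verts ?G. M v) = verts ?H" by simp
    show "independent_in ?H (M v)" if "v \<in> verts ?G" for v
    proof -
      have "\<not> adj H a b" if "a \<in> M v" "b \<in> M v" for a b
        using cover_adj(1)[OF c, of v v a b] that \<open>v \<in> verts ?G\<close> S M[of v] by auto
      then show ?thesis using that by (auto simp: independent_in_def)
    qed
    fix u v assume uv: "u \<in> verts ?G" "v \<in> verts ?G"
      and ne: "u \<noteq> v \<and> edges_between ?H (M u) (M v) \<noteq> {}"
    have V: "u \<in> verts G" "v \<in> verts G" "M u \<subseteq> L u" "M v \<subseteq> L v" using uv S M by auto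
    have eb: "edges_between ?H (M u) (M v) \<subseteq> edges_between H (L u) (L v)"
      using V by (auto simp: edges_between_def)
    then have *: "{u, v} \<in> edges G \<and> disjoint (edges_between H (L u) (L v))"
      using c V ne unfolding cover_def by blast
    then show "{u, v} \<in> edges ?G" using uv by simp
    show "disjoint (edges_between ?H (M u) (M v))"
    proof (rule disjointI)
      fix a b assume "a \<in> edges_between ?H (M u) (M v)" "b \<in> edges_between ?H (M u) (M v)" "a \<noteq> b"
      then show "a \<inter> b = {}" using * eb disjointD by blast
    qed
  qed
qed

text \<open>The only consequence of robust criticality that the join with a vertex needs.\<close>

lemma robustly_k_critical_perfect:
  fixes L :: "'a \<Rightarrow> 'c set"
  assumes rob: "robustly_k_critical k (induced G S)" and G: "simple_graph G" and S: "S \<subseteq> verts G"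
    and c: "cover G L H"
    and M: "\<And>v. v \<in> S \<Longrightarrow> M v \<subseteq> L v" "\<And>v. v \<in> S \<Longrightarrow> card (M v) = k - 1"
    and nc: "\<nexists>f. matching_family.col (adj H) S M f"
    and uv: "{u, v} \<in> edges G" "u \<in> S" "v \<in> S" and p: "p \<in> M u"
  shows "\<exists>d\<in>M v. adj H p d"
proof -
  let ?G = "induced G S" and ?H = "induced H (\<Union>v\<in>S. M v)"
  have c': "cover ?G M ?H" by (rule cover_induced[OF c S M(1)])
  have G': "simple_graph ?G" by (rule simple_graph_induced[OF G S])
  note mf = matching_family_cover[OF G c] and mf' = matching_family_cover[OF G' c']
  have "\<not> cover_coloring ?G M ?H T" for T
  proof
    assume "cover_coloring ?G M ?H T"
    then obtain f where "matching_family.col (adj ?H) S M f"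
      using cover_coloring_imp_col[OF _ mf'] by auto
    then have f: "\<And>v. v \<in> S \<Longrightarrow> f v \<in> M v"
      "\<And>u v. u \<in> S \<Longrightarrow> v \<in> S \<Longrightarrow> u \<noteq> v \<Longrightarrow> \<not> adj ?H (f u) (f v)"
      unfolding matching_family.col_def[OF mf'] by blast+
    have "\<not> adj H (f u) (f v)" if "u \<in> S" "v \<in> S" "u \<noteq> v" for u v
      using f(2)[OF that] f(1)[OF that(1)] f(1)[OF that(2)] that by auto
    then have "matching_family.col (adj H) S M f"
      unfolding matching_family.col_def[OF mf] using f(1) by blast
    then show False using nc by blast
  qed
  then have bad: "bad_cover ?G M ?H" using c' by (simp add: bad_cover_def)
  have "fold_cover (k - 1) ?G M ?H" using c' M(2) by (simp add: fold_cover_def)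
  then have "canonical_cover (k - 1) ?G M ?H"
    using robustly_k_critical_canonical[OF rob _ bad] by blast
  then obtain lam :: "'c \<Rightarrow> nat" where lam: "\<forall>v\<in>S. bij_betw lam (M v) {1..k - 1}"
    "\<forall>u v. {u, v} \<in> edges ?G \<longrightarrow> (\<forall>c\<in>M u. \<forall>c'\<in>M v. adj ?H c c' \<longleftrightarrow> lam c = lam c')"
    unfolding canonical_cover_def by auto
  have "lam ` M u = lam ` M v" using lam(1) uv(2,3) by (simp add: bij_betw_def)
  then have "lam p \<in> lam ` M v" using p by blast
  then obtain d where d: "d \<in> M v" "lam p = lam d" by blast
  then have "adj ?H p d" using lam(2) uv p by auto
  then show ?thesis using d by auto
qed

section \<open>Adding a universal vertex\<close>

locale universal_vertex =
  fixes G :: "'a graph" and w :: 'a and k :: nat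
  assumes simple: "simple_graph G" and w: "w \<in> verts G"
    and universal: "\<And>v. v \<in> verts G \<Longrightarrow> v \<noteq> w \<Longrightarrow> {w, v} \<in> edges G"
    and rob: "robustly_k_critical k (induced G (verts G - {w}))"
begin

abbreviation "V0 \<equiv> verts G - {w}"

lemma k_pos: "k \<ge> 1" and crit: "critical k (induced G V0)"
  using rob by (auto simp: robustly_k_critical_def)

text \<open>The colour of \<open>w\<close> occurs nowhere else, so on \<open>V0\<close> the colour
  \<open>k\<close> can be renamed to it, which frees one colour.\<close>

lemma not_colorable: "\<not> colorable G k"
proof
  assume "colorable G k"
  then obtain f where f: "f ` verts G \<subseteq> {1..k}" "\<And>u v. {u, v} \<in> edges G \<Longrightarrow> f u \<noteq> f v"
    by (auto simp: colorable_def proper_coloring_def)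
  define g where "g v = (if f v = k then f w else f v)" for v
  have fw: "f v \<noteq> f w" if "v \<in> V0" for v using f(2)[OF universal[of v]] that by auto
  have fV: "1 \<le> f v" "f v \<le> k" if "v \<in> verts G" for v using f(1) that by auto
  have "g v \<in> {1..k - 1}" if "v \<in> V0" for v
    using fV[of v] fV[OF w] fw[OF that] that by (auto simp: g_def)
  moreover have "g u \<noteq> g v" if "{u, v} \<in> edges (induced G V0)" for u v
  proof -
    have "u \<in> V0" "v \<in> V0" "f u \<noteq> f v" using that f(2) by auto
    then show ?thesis using fw[of u] fw[of v] by (auto simp: g_def)
  qed
  ultimately have "proper_coloring (induced G V0) (k - 1) g"
    unfolding proper_coloring_def image_subset_iff induced_simps(1) by blast
  then show False using critical_not_colorable[OF crit k_pos] by (auto simp: colorable_def)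
qed

lemma nonempty: "V0 \<noteq> {}"
proof -
  have "simple_graph (induced G V0)" using simple by (intro simple_graph_induced) auto
  then show ?thesis using not_colorable_nonempty critical_not_colorable[OF crit k_pos] by fastforce
qed

lemma canonical:
  fixes L :: "'a \<Rightarrow> 'c set"
  assumes fold: "fold_cover k G L H" and bad: "bad_cover G L H"
  shows "canonical_cover k G L H"
proof -
  have c: "cover G L H" using fold by (simp add: fold_cover_def)
  have cL: "card (L v) = k" if "v \<in> verts G" for v using fold that by (simp add: fold_cover_def)
  interpret matching_family "verts G" L "adj H" by (rule matching_family_cover[OF simple c])
  have nocol: "\<nexists>f. col (verts G) L f"
    using bad col_imp_cover_coloring[OF c _ matching_family_axioms] by (auto simp: bad_cover_def)
  have V0: "V0 \<subseteq> verts G" by blast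
  have insV: "insert w V0 = verts G" using w by blast
  have sub_nocol: "\<nexists>f. col V0 M f" if x: "x \<in> L w"
    and M: "\<And>v. v \<in> V0 \<Longrightarrow> M v \<subseteq> avail {w} (\<lambda>_. x) L v" for x M
  proof
    assume "\<exists>f. col V0 M f"
    then obtain f where f: "col V0 M f" by blast
    then have fv: "f v \<in> L v \<and> \<not> adj H x (f v)" if "v \<in> V0" for v
      using M that unfolding col_def avail_def by blast
    then have "col V0 L f" using f by (auto simp: col_def)
    then have "col (insert w V0) L (f(w := x))"
      using x fv by (intro col_insert) (auto simp: insert_commute)
    then show False using nocol insV by auto
  qed
  \<comment> \<open>Until \<open>x\<close> is known to have a partner in every list, the shortened
    lists may still have \<open>k\<close> colours. Therefore all choices of sublists with
    \<open>k - 1\<close> colours are allowed.\<close>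
  have perfect: "\<exists>d\<in>M v. adj H p d"
    if x: "x \<in> L w" and M: "\<And>v. v \<in> V0 \<Longrightarrow> M v \<subseteq> avail {w} (\<lambda>_. x) L v"
      "\<And>v. v \<in> V0 \<Longrightarrow> card (M v) = k - 1"
      and uv: "{u, v} \<in> edges G" "u \<in> V0" "v \<in> V0" and p: "p \<in> M u" for x M u v p
    using robustly_k_critical_perfect[OF rob simple V0 c _ M(2) sub_nocol[OF x M(1)] uv p]
      M(1) avail_subset by (meson order_trans)
  have avail_card: "k - 1 \<le> card (avail {w} (\<lambda>_. x) L v)" if "x \<in> L w" "v \<in> V0" for x v
    using card_avail1[of w v L x] that w cL[of v] by auto
  have w_nb: "perf w v" if v: "v \<in> V0" for v
    unfolding perf_def
  proof (rule ballI, rule ccontr)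
    fix x assume x: "x \<in> L w" and neg: "\<not> (\<exists>d\<in>L v. adj H x d)"
    have full: "avail {w} (\<lambda>_. x) L v = L v" using neg by (auto simp: avail_def)
    have ne: "L v \<noteq> {}" using cL[of v] v k_pos by fastforce
    show False
    \<comment> \<open>For \<open>k = 1\<close> the old graph is a single vertex, so there is no
      neighbour \<open>u\<close> to argue with.\<close>
    proof (cases "k = 1")
      case True
      then obtain v' where "V0 = {v'}"
        using critical_1[of "induced G V0"] crit by auto
      then have "V0 = {v}" using v by (metis singletonD)
      moreover obtain d where "d \<in> L v" using ne by blast
      ultimately have "col V0 (avail {w} (\<lambda>_. x) L) (\<lambda>_. d)" using full by (auto simp: col_def)
      then show False using sub_nocol[OF x] by blast
    next
      case False
      then have k2: "k \<ge> 2" using k_pos by linarith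
      then obtain u where u: "{u, v} \<in> edges G" "u \<in> V0"
        using critical_no_isolated[OF crit, of v] v by auto
      have "u \<noteq> v" using simple_graph_edge[OF simple u(1)] by simp
      have "\<forall>v\<in>V0. \<exists>A. A \<subseteq> avail {w} (\<lambda>_. x) L v \<and> card A = k - 1"
        using avail_card[OF x] by (meson obtain_subset_with_card_n)
      then obtain M0 where M0: "\<And>v. v \<in> V0 \<Longrightarrow> M0 v \<subseteq> avail {w} (\<lambda>_. x) L v"
        "\<And>v. v \<in> V0 \<Longrightarrow> card (M0 v) = k - 1" by metis
      have "card (M0 u) \<noteq> 0" using M0(2)[OF u(2)] k2 by simp
      then obtain p where p: "p \<in> M0 u" by fastforce
      \<comment> \<open>Since \<open>v\<close> has kept all \<open>k\<close> colours, any
        \<open>y\<close> may be the one left out of its list. The partner of \<open>p\<close> can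
        thus be made to avoid any given colour, which yields two different partners.\<close>
      have p_nb: "\<exists>d \<in> L v - {y}. adj H p d" if y: "y \<in> L v" for y
      proof -
        let ?M = "M0(v := L v - {y})"
        have "card (L v - {y}) = k - 1" using y cL[of v] v by simp
        then have "\<exists>d\<in>?M v. adj H p d"
          using M0 full p u v \<open>u \<noteq> v\<close> by (intro perfect[OF x, of ?M u v p]) auto
        then show ?thesis by simp
      qed
      obtain d where d: "d \<in> L v" "adj H p d" using p_nb ne by blast
      then obtain d' where "d' \<in> L v" "d' \<noteq> d" "adj H p d'" using p_nb[OF d(1)] by blast
      moreover have "p \<in> L u" using M0(1)[OF u(2)] p avail_subset by blast
      ultimately show False
        using R_matching[of u v p d d'] d u v \<open>u \<noteq> v\<close> by auto
    qed
  qed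
  have v_nb: "perf v w" if "v \<in> V0" for v
    using that w cL w_nb by (intro perf_sym[of w v]) auto
  have nb_adj: "adj H x d \<longleftrightarrow> x = nb w d" if "v \<in> V0" "x \<in> L w" "d \<in> L v" for x v d
  proof
    assume "adj H x d"
    then have "adj H d x" by (rule R_sym)
    then show "x = nb w d" using nb_eq[of v w d x] that w by auto
  next
    assume "x = nb w d"
    then show "adj H x d" using R_sym[OF nb_R[OF v_nb[OF that(1)] that(3)]] by simp
  qed
  have bij_w: "bij_betw (nb w) (L v) (L w)" if "v \<in> V0" for v
    using that w cL v_nb by (intro bij_nb) auto
  have avail_eq: "avail {w} (\<lambda>_. x) L v = {d \<in> L v. nb w d \<noteq> x}" if "x \<in> L w" "v \<in> V0" for x v
    using nb_adj that by (auto simp: avail_def)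
  have avail_card_eq: "card (avail {w} (\<lambda>_. x) L v) = k - 1" if x: "x \<in> L w" and v: "v \<in> V0" for x v
  proof -
    have "x \<in> nb w ` L v" using bij_betw_imp_surj_on[OF bij_w[OF v]] x by simp
    then obtain d where d: "d \<in> L v" "nb w d = x" by blast
    have "nb w e = x \<longleftrightarrow> e = d" if "e \<in> L v" for e
      using inj_on_eq_iff[OF bij_betw_imp_inj_on[OF bij_w[OF v]] that d(1)] d(2) by simp
    then have "avail {w} (\<lambda>_. x) L v = L v - {d}"
      unfolding avail_eq[OF x v] by auto
    then show ?thesis using d v cL[of v] by simp
  qed
  \<comment> \<open>From here on \<open>nb w\<close> is the label of a colour. Colouring
    \<open>w\<close> by \<open>x\<close> removes exactly the colours labelled \<open>x\<close>, and
    the remaining lists are perfectly matched along edges of the old graph.\<close>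
  have step: "\<exists>d. d \<in> L v \<and> nb w d \<noteq> x \<and> adj H p d"
    if x: "x \<in> L w" and uv: "{u, v} \<in> edges G" "u \<in> V0" "v \<in> V0" and p: "p \<in> L u" "nb w p \<noteq> x"
    for x u v p
  proof -
    have "p \<in> avail {w} (\<lambda>_. x) L u" unfolding avail_eq[OF x uv(2)] using p by simp
    then have "\<exists>d\<in>avail {w} (\<lambda>_. x) L v. adj H p d"
      by (intro perfect[OF x, of "avail {w} (\<lambda>_. x) L" u v p] order_refl avail_card_eq[OF x] uv)
    then show ?thesis unfolding avail_eq[OF x uv(3)] by blast
  qed
  have inner: "adj H p d \<longleftrightarrow> nb w p = nb w d"
    if uv: "{u, v} \<in> edges G" "u \<in> V0" "v \<in> V0" and pd: "p \<in> L u" "d \<in> L v" for u v p d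
  proof
    have V: "u \<in> verts G" "v \<in> verts G" "u \<noteq> v" using simple_graph_edge[OF simple uv(1)] by auto
    have nw: "nb w p \<in> L w" "nb w d \<in> L w" using nb_in v_nb uv pd by blast+
    show "nb w p = nb w d" if "adj H p d"
    proof (rule ccontr)
      assume ne: "nb w p \<noteq> nb w d"
      \<comment> \<open>With \<open>w\<close> coloured by the label of \<open>p\<close>, the colour
        \<open>d\<close> survives but \<open>p\<close>, its only possible partner in
        \<open>L u\<close>, does not.\<close>
      obtain q where q: "q \<in> L u" "nb w q \<noteq> nb w p" "adj H d q"
        using step[OF nw(1), of v u d] uv pd ne by (auto simp: insert_commute)
      then have "q = p" using R_matching[of v u d q p] V pd R_sym[OF that] by auto
      then show False using q by simp
    qed
    show "adj H p d" if eq: "nb w p = nb w d"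
    proof -
      have "k \<noteq> 1"
      proof
        assume "k = 1"
        then have "edges (induced G V0) = {}" using critical_1[of "induced G V0"] crit by auto
        then show False using uv by auto
      qed
      then have "card (L w) \<ge> 2" using k_pos cL[OF w] by simp
      then have "\<not> L w \<subseteq> {nb w p}" using card_mono[of "{nb w p}" "L w"] by auto
      \<comment> \<open>A label other than that of \<open>p\<close> is chosen for \<open>w\<close>,
        so that \<open>p\<close> survives and has a partner \<open>e\<close>; the previous
        comparison then forces \<open>e\<close> to have the label of \<open>p\<close>.\<close>
      then obtain y where y: "y \<in> L w" "y \<noteq> nb w p" by blast
      then obtain e where e: "e \<in> L v" "adj H p e" using step[OF y(1) uv pd(1)] by auto
      have "nb w e = nb w p"
      proof (rule ccontr)
        assume ne: "nb w e \<noteq> nb w p"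
        obtain q where q: "q \<in> L u" "nb w q \<noteq> nb w p" "adj H e q"
          using step[OF nw(1), of v u e] uv e ne by (auto simp: insert_commute)
        then have "q = p" using R_matching[of v u e q p] V pd e R_sym[OF e(2)] by auto
        then show False using q by simp
      qed
      then have "e = d"
        using inj_onD[OF bij_betw_imp_inj_on[OF bij_w[OF uv(3)]], of e d] e pd eq by simp
      then show ?thesis using e by simp
    qed
  qed
  show ?thesis
  proof (rule canonical_coverI[OF fold simple, of "L w" "\<lambda>v. if v = w then id else nb w"])
    show "finite (L w)" "card (L w) = k" using finite_L w cL by auto
    show "bij_betw (if v = w then id else nb w) (L v) (L w)" if "v \<in> verts G" for v
      using that bij_w by auto
    fix u v p d assume uv: "{u, v} \<in> edges G" and pd: "p \<in> L u" "d \<in> L v"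
    have V: "u \<in> verts G" "v \<in> verts G" "u \<noteq> v" using simple_graph_edge[OF simple uv] by auto
    consider "u = w" "v \<in> V0" | "v = w" "u \<in> V0" | "u \<in> V0" "v \<in> V0" using V by blast
    then show "adj H p d \<longleftrightarrow> (if u = w then id else nb w) p = (if v = w then id else nb w) d"
    proof cases
      case 1
      then show ?thesis using nb_adj pd V by auto
    next
      case 2
      then have "adj H d p \<longleftrightarrow> d = nb w p" using nb_adj pd by blast
      then show ?thesis using 2 V by (auto simp: insert_commute)
    next
      case 3
      then show ?thesis using inner uv pd by auto
    qed
  qed
qed

lemma robustly_k_critical_Suc: "robustly_k_critical (Suc k) G"
proof (rule robustly_k_criticalI[OF simple])
  show "2 \<le> Suc k" using k_pos by simp
  show "\<exists>u. {u, v} \<in> edges G" if v: "v \<in> verts G" for v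
  proof (cases "v = w")
    case True
    then show ?thesis using nonempty universal by (metis Diff_iff all_not_in_conv insert_commute singletonI)
  next
    case False
    then show ?thesis using universal v by blast
  qed
  show "\<not> colorable G (Suc k - 1)" using not_colorable by simp
  show "canonical_cover (Suc k - 1) G L H" if "fold_cover (Suc k - 1) G L H" "bad_cover G L H"
    for L :: "'a \<Rightarrow> nat set" and H
    using canonical that by simp
qed

end

text \<open>Needed to start the induction on \<open>t\<close>: the join with the empty complete
  graph is not \<open>G\<close> but its copy under \<open>Inl\<close>, over a different
  type.\<close>

lemma robustly_k_critical_map_graph:
  assumes rob: "robustly_k_critical k G" and inj: "inj_on f (verts G)"
  shows "robustly_k_critical k (map_graph f G)"
proof -
  have k: "k \<ge> 1" and crit: "critical k G" using rob by (auto simp: robustly_k_critical_def)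
  then have s: "simple_graph G" by (simp add: critical_def)
  let ?G = "map_graph f G"
  have s': "simple_graph ?G" by (rule simple_graph_map_graph[OF s inj])
  have V': "verts ?G = f ` verts G" by (simp add: map_graph_def)
  have adj_iff: "adj ?G (f u) (f v) \<longleftrightarrow> adj G u v" if "u \<in> verts G" "v \<in> verts G" for u v
    by (rule map_graph_edge_iff[OF s inj that])
  have nc: "\<not> colorable ?G (k - 1)"
  proof
    assume "colorable ?G (k - 1)"
    then obtain g where g: "proper_coloring ?G (k - 1) g" by (auto simp: colorable_def)
    have "proper_coloring G (k - 1) (g \<circ> f)"
      unfolding proper_coloring_def
    proof (intro conjI allI impI)
      show "(g \<circ> f) ` verts G \<subseteq> {1..k - 1}"
        using g by (auto simp: proper_coloring_def V')
      fix u v assume "adj G u v"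
      then have "adj ?G (f u) (f v)" using adj_iff simple_graph_edge[OF s] by blast
      then show "(g \<circ> f) u \<noteq> (g \<circ> f) v" using g by (auto simp: proper_coloring_def)
    qed
    then show False using critical_not_colorable[OF crit k] by (auto simp: colorable_def)
  qed
  have sub: "colorable G' (k - 1)" if G': "subgraph G' ?G" "G' \<noteq> ?G" for G'
  proof -
    have sG': "simple_graph G'" using G' by (simp add: subgraph_def)
    \<comment> \<open>The preimage of \<open>G'\<close> under \<open>f\<close> is a proper subgraph
      of \<open>G\<close>; its colouring is carried to \<open>G'\<close> by the inverse of
      \<open>f\<close>.\<close>
    define G'' where "G'' = Graph {v \<in> verts G. f v \<in> verts G'} {e \<in> edges G. f ` e \<in> edges G'}"
    have "e \<subseteq> verts G''" if "e \<in> edges G''" for e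
      using that s sG' by (fastforce simp: G''_def simple_graph_def)
    then have "subgraph G'' G"
      using s by (auto simp: subgraph_def simple_graph_def G''_def)
    moreover have "G'' \<noteq> G"
    proof
      assume "G'' = G"
      then have "f v \<in> verts G'" if "v \<in> verts G" for v
      proof -
        have "v \<in> verts G''" using that \<open>G'' = G\<close> by simp
        then show ?thesis by (simp add: G''_def)
      qed
      moreover have "f ` e \<in> edges G'" if "e \<in> edges G" for e
      proof -
        have "e \<in> edges G''" using that \<open>G'' = G\<close> by simp
        then show ?thesis by (simp add: G''_def)
      qed
      ultimately have "verts ?G \<subseteq> verts G'" "edges ?G \<subseteq> edges G'" by (auto simp: map_graph_def)
      then have "verts G' = verts ?G" "edges G' = edges ?G" using G'(1) by (auto simp: subgraph_def)
      then show False using G'(2) by (simp add: graph.expand)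
    qed
    ultimately have "chromatic_number G'' < k" "simple_graph G''"
      using crit by (auto simp: critical_def subgraph_def)
    then obtain g where g: "proper_coloring G'' (k - 1) g"
      using chromatic_number_less_iff[of G'' k] k by (auto simp: colorable_def)
    let ?h = "inv_into (verts G) f"
    have h: "?h x \<in> verts G" "f (?h x) = x" if "x \<in> verts G'" for x
    proof -
      have "x \<in> f ` verts G" using that G'(1) V' by (auto simp: subgraph_def)
      then show "?h x \<in> verts G" "f (?h x) = x" by (rule inv_into_into, rule f_inv_into_f)
    qed
    have "proper_coloring G' (k - 1) (g \<circ> ?h)"
      unfolding proper_coloring_def
    proof (intro conjI allI impI)
      have "?h x \<in> verts G''" if "x \<in> verts G'" for x using h[OF that] that by (simp add: G''_def)
      then show "(g \<circ> ?h) ` verts G' \<subseteq> {1..k - 1}"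
        using g by (auto simp: proper_coloring_def image_subset_iff)
      fix x y assume xy: "adj G' x y"
      then have V: "x \<in> verts G'" "y \<in> verts G'" using simple_graph_edge[OF sG'] by blast+
      have "adj ?G x y" using xy G'(1) by (auto simp: subgraph_def)
      then have "adj G (?h x) (?h y)"
        using adj_iff[OF h(1)[OF V(1)] h(1)[OF V(2)]] h(2)[OF V(1)] h(2)[OF V(2)] by simp
      moreover have "f ` {?h x, ?h y} \<in> edges G'" using h(2)[OF V(1)] h(2)[OF V(2)] xy by simp
      ultimately have "adj G'' (?h x) (?h y)" by (simp add: G''_def)
      then show "(g \<circ> ?h) x \<noteq> (g \<circ> ?h) y" using g by (auto simp: proper_coloring_def)
    qed
    then show ?thesis by (auto simp: colorable_def)
  qed
  obtain g where g: "proper_coloring G k g"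
    using colorable_chromatic_number[OF s] crit by (auto simp: critical_def colorable_def)
  have "colorable ?G k"
  proof -
    let ?h = "inv_into (verts G) f"
    have h: "?h (f v) = v" if "v \<in> verts G" for v by (rule inv_into_f_f[OF inj that])
    have "proper_coloring ?G k (g \<circ> ?h)"
      unfolding proper_coloring_def
    proof (intro conjI allI impI)
      show "(g \<circ> ?h) ` verts ?G \<subseteq> {1..k}"
        using g h by (auto simp: proper_coloring_def V' image_subset_iff)
      fix x y assume xy: "adj ?G x y"
      then obtain u v where uv: "u \<in> verts G" "v \<in> verts G" "x = f u" "y = f v"
        using simple_graph_edge[OF s' xy] V' by auto
      then have "adj G u v" using xy adj_iff by simp
      then show "(g \<circ> ?h) x \<noteq> (g \<circ> ?h) y" using g h uv by (auto simp: proper_coloring_def)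
    qed
    then show ?thesis by (auto simp: colorable_def)
  qed
  then have "chromatic_number ?G \<le> k" using chromatic_number_le_iff[OF s'] by blast
  moreover have "\<not> chromatic_number ?G < k" using chromatic_number_less_iff[OF s' k] nc by blast
  ultimately have "chromatic_number ?G = k" by linarith
  moreover have "chromatic_number G' < k" if "subgraph G' ?G" "G' \<noteq> ?G" for G'
    using sub[OF that] chromatic_number_less_iff[of G' k] k that by (auto simp: subgraph_def)
  ultimately have crit': "critical k ?G" using s' by (auto simp: critical_def)
  have "canonical_cover (k - 1) ?G L H"
    if fold: "fold_cover (k - 1) ?G L H" and bad: "bad_cover ?G L H" for L :: "_ \<Rightarrow> nat set" and H
  proof -
    have c': "cover ?G L H" using bad by (simp add: bad_cover_def)
    have c: "cover G (L \<circ> f) H"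
      unfolding cover_def
    proof (intro conjI ballI impI)
      show "simple_graph H" using c' by (simp add: cover_def)
      show "disjoint_family_on (L \<circ> f) (verts G)"
        unfolding disjoint_family_on_def
      proof (intro ballI impI)
        fix u v assume "u \<in> verts G" "v \<in> verts G" "u \<noteq> v"
        then have "f u \<noteq> f v" "f u \<in> verts ?G" "f v \<in> verts ?G" using inj V' by (auto simp: inj_on_def)
        then show "(L \<circ> f) u \<inter> (L \<circ> f) v = {}" using cover_owner_unique[OF c'] by fastforce
      qed
      show "independent_in H ((L \<circ> f) v)" if "v \<in> verts G" for v
        using c' that by (simp add: cover_def V')
      show "(\<Union>v\<in>verts G. (L \<circ> f) v) = verts H" using c' by (simp add: cover_def V')
      fix u v assume V: "u \<in> verts G" "v \<in> verts G"
        and ne: "u \<noteq> v \<and> edges_between H ((L \<circ> f) u) ((L \<circ> f) v) \<noteq> {}"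
      then have "f u \<noteq> f v" "f u \<in> verts ?G" "f v \<in> verts ?G" using inj V' by (auto simp: inj_on_def)
      then have "adj ?G (f u) (f v) \<and> disjoint (edges_between H (L (f u)) (L (f v)))"
        using c' ne unfolding cover_def comp_def by blast
      then show "adj G u v" "disjoint (edges_between H ((L \<circ> f) u) ((L \<circ> f) v))"
        using adj_iff[OF V] by auto
    qed
    have "\<not> cover_coloring G (L \<circ> f) H T" for T
      using bad by (auto simp: bad_cover_def cover_coloring_def V')
    then have "bad_cover G (L \<circ> f) H" using c by (simp add: bad_cover_def)
    moreover have "fold_cover (k - 1) G (L \<circ> f) H" using fold c by (simp add: fold_cover_def V')
    ultimately have "canonical_cover (k - 1) G (L \<circ> f) H"
      using rob by (simp add: robustly_k_critical_def)
    then obtain lam :: "nat \<Rightarrow> nat" where lam: "\<forall>v\<in>verts G. bij_betw lam (L (f v)) {1..k - 1}"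
      "\<And>u v. adj G u v \<Longrightarrow> (\<forall>c\<in>L (f u). \<forall>c'\<in>L (f v). adj H c c' \<longleftrightarrow> lam c = lam c')"
      unfolding canonical_cover_def by auto
    have "\<forall>c\<in>L x. \<forall>c'\<in>L y. adj H c c' \<longleftrightarrow> lam c = lam c'" if xy: "adj ?G x y" for x y
    proof -
      obtain u v where uv: "u \<in> verts G" "v \<in> verts G" "x = f u" "y = f v"
        using simple_graph_edge[OF s' xy] V' by auto
      then have "adj G u v" using xy adj_iff by simp
      then show ?thesis using lam(2) uv by blast
    qed
    moreover have "\<forall>x\<in>verts ?G. bij_betw lam (L x) {1..k - 1}" using lam(1) V' by simp
    ultimately show ?thesis using fold unfolding canonical_cover_def by blast
  qed
  then show ?thesis using k crit' by (simp add: robustly_k_critical_def)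
qed

section \<open>Joins with complete graphs, one vertex at a time\<close>

lemma join_complete_graph_0: "join G (complete_graph 0) = map_graph Inl G"
  by (auto simp: join_def complete_graph_def map_graph_def)

lemma verts_join [simp]: "verts (join G H) = verts G <+> verts H"
  and edges_join: "edges (join G H) = (`) Inl ` edges G \<union> (`) Inr ` edges H \<union>
    {{Inl u, Inr v} | u v. u \<in> verts G \<and> v \<in> verts H}"
  by (simp_all add: join_def)

lemma simple_complete_graph: "simple_graph (complete_graph t)"
  by (auto simp: simple_graph_def complete_graph_def)

lemma simple_graph_join:
  assumes "simple_graph G" "simple_graph H"
  shows "simple_graph (join G H)"
  unfolding simple_graph_def
proof (intro conjI ballI)
  show "finite (verts (join G H))" using assms by (simp add: simple_graph_def)
  fix e assume "e \<in> edges (join G H)"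
  then consider d where "d \<in> edges G" "e = Inl ` d" | d where "d \<in> edges H" "e = Inr ` d"
    | u v where "u \<in> verts G" "v \<in> verts H" "e = {Inl u, Inr v}"
    by (auto simp: edges_join)
  then have "e \<subseteq> verts (join G H) \<and> card e = 2"
  proof cases
    case 1
    then show ?thesis using assms(1) by (auto simp: simple_graph_def card_image)
  next
    case 2
    then show ?thesis using assms(2) by (auto simp: simple_graph_def card_image)
  next
    case 3
    then show ?thesis by auto
  qed
  then show "e \<subseteq> verts (join G H)" "card e = 2" by auto
qed

lemma verts_complete_graph [simp]: "verts (complete_graph t) = {1..t}"
  by (simp add: complete_graph_def)

lemma edge_complete_graph_iff:
  "{i, j} \<in> edges (complete_graph t) \<longleftrightarrow> i \<in> {1..t} \<and> j \<in> {1..t} \<and> i \<noteq> j"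
  by (auto simp: complete_graph_def doubleton_eq_iff)

lemma induced_complete_graph: "induced (complete_graph (Suc t)) {1..t} = complete_graph t"
proof (rule graph.expand, intro conjI)
  have "e \<in> edges (complete_graph t)" if "e \<in> edges (complete_graph (Suc t))" "e \<subseteq> {1..t}" for e
  proof -
    have "card e = 2" using that(1) simple_complete_graph by (simp add: simple_graph_def)
    then obtain i j where "e = {i, j}" by (meson card_2_iff)
    then show ?thesis using that edge_complete_graph_iff by simp
  qed
  moreover have "e \<in> edges (complete_graph (Suc t)) \<and> e \<subseteq> {1..t}"
    if "e \<in> edges (complete_graph t)" for e
  proof -
    have "card e = 2" using that(1) simple_complete_graph by (simp add: simple_graph_def)
    then obtain i j where "e = {i, j}" by (meson card_2_iff)
    then show ?thesis using that edge_complete_graph_iff by auto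
  qed
  ultimately show "edges (induced (complete_graph (Suc t)) {1..t}) = edges (complete_graph t)"
    by auto
qed (simp add: complete_graph_def)

lemma induced_join:
  assumes "simple_graph G" "S \<subseteq> verts H"
  shows "induced (join G H) (verts G <+> S) = join G (induced H S)"
proof (rule graph.expand, intro conjI)
  show "edges (induced (join G H) (verts G <+> S)) = edges (join G (induced H S))"
    (is "?A = ?B")
  proof (intro equalityI subsetI)
    fix e assume "e \<in> ?A"
    then have "e \<in> edges (join G H)" and sub: "e \<subseteq> verts G <+> S" by auto
    then consider d where "d \<in> edges G" "e = Inl ` d" | d where "d \<in> edges H" "e = Inr ` d"
      | u v where "u \<in> verts G" "v \<in> verts H" "e = {Inl u, Inr v}"
      by (auto simp: edges_join)
    then show "e \<in> ?B"
      using sub by cases (auto simp: edges_join)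
  next
    fix e assume "e \<in> ?B"
    then consider d where "d \<in> edges G" "e = Inl ` d" | d where "d \<in> edges H" "d \<subseteq> S" "e = Inr ` d"
      | u v where "u \<in> verts G" "v \<in> S" "e = {Inl u, Inr v}"
      by (auto simp: edges_join)
    then show "e \<in> ?A"
    proof cases
      case 1
      then have "d \<subseteq> verts G" using assms(1) by (simp add: simple_graph_def)
      then show ?thesis using 1 by (auto simp: edges_join)
    qed (use assms in \<open>auto simp: edges_join\<close>)
  qed
qed simp

lemma robustly_k_critical_join:
  assumes rob: "robustly_k_critical k G"
  shows "robustly_k_critical (k + t) (join G (complete_graph t))"
proof (induction t)
  case 0
  then show ?case
    using robustly_k_critical_map_graph[OF rob, of Inl] by (simp add: join_complete_graph_0)
next
  case (Suc t)
  have s: "simple_graph G" using rob by (simp add: robustly_k_critical_def critical_def)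
  let ?J = "join G (complete_graph (Suc t))" and ?w = "Inr (Suc t)"
  have V: "verts ?J - {?w} = verts G <+> {1..t}"
    by (auto simp: complete_graph_def)
  have "universal_vertex ?J ?w (k + t)"
  proof
    show "simple_graph ?J" by (rule simple_graph_join[OF s simple_complete_graph])
    show "?w \<in> verts ?J" by (auto simp: complete_graph_def)
    show "adj ?J ?w v" if "v \<in> verts ?J" "v \<noteq> ?w" for v
    proof (cases v)
      case (Inl u)
      then have "{Inl u, ?w} \<in> edges ?J" using that by (auto simp: edges_join complete_graph_def)
      then show ?thesis using Inl by (simp add: insert_commute)
    next
      case (Inr i)
      then have "{Suc t, i} \<in> edges (complete_graph (Suc t))"
        unfolding edge_complete_graph_iff using that by (auto simp: complete_graph_def)
      then have "Inr ` {Suc t, i} \<in> edges ?J" unfolding edges_join by blast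
      then show ?thesis using Inr by simp
    qed
    have "induced ?J (verts ?J - {?w}) = join G (complete_graph t)"
      unfolding V induced_complete_graph[of t, symmetric] by (rule induced_join[OF s]) auto
    then show "robustly_k_critical (k + t) (induced ?J (verts ?J - {?w}))" using Suc.IH by simp
  qed
  then show ?case using universal_vertex.robustly_k_critical_Suc by fastforce
qed

section \<open>The graphs \<open>E\<^sub>k\<^sub>,\<^sub>a\<^sub>,\<^sub>b\<close>\<close>

text \<open>One of the two cliques together with \<open>z\<close>, with \<open>m\<close> colours in
  every list. The ambient \<open>V\<close>, \<open>L\<close>, \<open>R\<close> are those of the
  whole cover, so both sides are instances over the same data.\<close>

locale half_cover = matching_family V L R
  for V :: "'a set" and L :: "'a \<Rightarrow> 'c set" and R +
  fixes S1 S2 :: "'a set" and z :: 'a and m :: nat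
  assumes in_V: "S1 \<subseteq> V" "S2 \<subseteq> V" "z \<in> V"
    and dis: "S1 \<inter> S2 = {}" "z \<notin> S1" "z \<notin> S2"
    and nonempty: "S1 \<noteq> {}" "S2 \<noteq> {}"
    and card_S: "card S1 + card S2 = m"
    and card_L: "v \<in> V \<Longrightarrow> card (L v) = m"
    and z_S2: "\<lbrakk>c \<in> L z; v \<in> S2; d \<in> L v\<rbrakk> \<Longrightarrow> \<not> R c d"
begin

definition lists :: "('a \<Rightarrow> 'c) \<Rightarrow> 'c \<Rightarrow> 'a \<Rightarrow> 'c set" where
  "lists f c = avail {z} (\<lambda>_. c) (avail S2 f L)"

definition blocked :: "('a \<Rightarrow> 'c) \<Rightarrow> 'c set" where
  "blocked f = {c \<in> L z. \<nexists>g. col S1 (lists f c) g}"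

lemma fin: "finite S1" "finite S2"
  using in_V finite_V finite_subset by blast+

lemma card_pos: "0 < card S1" "0 < card S2"
  using fin nonempty by (auto simp: card_gt_0_iff)

lemma lists_subset: "lists f c v \<subseteq> avail S2 f L v" "lists f c v \<subseteq> L v"
  by (auto simp: lists_def avail_def)

lemma card_avail_S2:
  assumes "col S2 L f" "x \<in> S1"
  shows "card S1 \<le> card (avail S2 f L x)"
proof -
  have "card (L x) \<le> card (avail S2 f L x) + card S2"
    using assms in_V dis by (intro card_avail) (auto simp: col_def)
  then show ?thesis using card_L card_S assms in_V by fastforce
qed

lemma card_lists:
  assumes "x \<in> S1" "c \<in> L z"
  shows "card (avail S2 f L x) \<le> Suc (card (lists f c x))"
  unfolding lists_def
  using assms in_V dis by (intro card_avail1) (auto simp: avail_def)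

text \<open>\<open>S2\<close> costs a vertex of \<open>S1\<close> at most \<open>card S2\<close> of
  its \<open>m\<close> colours and \<open>z\<close> at most one more, so the lists fall short of
  \<open>card S1\<close> by at most one. A failing greedy colouring permits no slack
  anywhere.\<close>

lemma lists_tight:
  assumes f: "col S2 L f" and c: "c \<in> blocked f" and x: "x \<in> S1"
  shows "card S1 = Suc (card (lists f c x))"
proof (rule clique_tight[OF in_V(1) lists_subset(2) _ _ x])
  show "card S1 \<le> Suc (card (lists f c v))" if "v \<in> S1" for v
    using card_avail_S2[OF f that] card_lists[OF that, of c f] c by (auto simp: blocked_def)
  show "\<nexists>g. col S1 (lists f c) g" using c by (auto simp: blocked_def)
qed

lemma card_avail_eq:
  assumes f: "col S2 L f" and c: "c \<in> blocked f" and x: "x \<in> S1"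
  shows "card (avail S2 f L x) = card S1"
  using card_avail_S2[OF f x] card_lists[OF x, of c f] lists_tight[OF assms] c
  by (auto simp: blocked_def)

lemma blocked_nb:
  assumes f: "col S2 L f" and c: "c \<in> blocked f" and x: "x \<in> S1"
  shows "\<exists>d \<in> avail S2 f L x. R c d"
proof (rule ccontr)
  assume "\<not> ?thesis"
  then have "lists f c x = avail S2 f L x" by (auto simp: lists_def avail_def)
  then show False using lists_tight[OF assms] card_avail_eq[OF assms] by simp
qed

text \<open>If \<open>f u\<close> removed no colour from \<open>L x\<close>, the other
  \<open>card S2 - 1\<close> vertices would have to remove \<open>card S2\<close> of them.\<close>

lemma blocked_S2_nb:
  assumes f: "col S2 L f" and c: "c \<in> blocked f" and x: "x \<in> S1" and u: "u \<in> S2"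
  shows "\<exists>d \<in> L x. R (f u) d"
proof (rule ccontr)
  assume "\<not> ?thesis"
  then have "avail (S2 - {u}) f L x = avail S2 f L x" by (auto simp: avail_def)
  then have "card (avail (S2 - {u}) f L x) = card S1" using card_avail_eq[OF f c x] by simp
  moreover have "card (L x) \<le> card (avail (S2 - {u}) f L x) + card (S2 - {u})"
    using x f in_V dis by (intro card_avail) (auto simp: col_def)
  moreover have "card S2 = Suc (card (S2 - {u}))" using fin u by (metis card_Suc_Diff1)
  moreover have "card (L x) = m" using card_L x in_V by blast
  ultimately show False using card_S by linarith
qed

lemma blocked_subset: "blocked f \<subseteq> L z"
  by (auto simp: blocked_def)

lemma finite_avail: "v \<in> V \<Longrightarrow> finite (avail S f L v)"
  by (rule finite_subset[OF avail_subset finite_L])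

lemma nb_blocked:
  assumes f: "col S2 L f" and x: "x \<in> S1" and c: "c \<in> blocked f"
  shows "nb x c \<in> avail S2 f L x" "R c (nb x c)"
proof -
  obtain d where d: "d \<in> avail S2 f L x" "R c d" using blocked_nb[OF f c x] by blast
  then have "nb x c = d"
    using blocked_subset c x dis in_V by (intro nb_eq[of z]) (auto simp: avail_def)
  then show "nb x c \<in> avail S2 f L x" "R c (nb x c)" using d by auto
qed

lemma inj_nb_blocked:
  assumes f: "col S2 L f" and x: "x \<in> S1"
  shows "inj_on (nb x) (blocked f)"
  using blocked_nb[OF f _ x] avail_subset x in_V dis
  by (intro inj_on_nb[OF in_V(3) _ _ blocked_subset]) blast+

text \<open>Each blocked colour has its own partner among the colours that \<open>f\<close> leaves
  free at \<open>x\<close>, and exactly \<open>card S1\<close> are free there.\<close>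

lemma card_blocked_le:
  assumes f: "col S2 L f"
  shows "card (blocked f) \<le> card S1"
proof (cases "blocked f = {}")
  case False
  then obtain c where c: "c \<in> blocked f" by blast
  obtain x where x: "x \<in> S1" using nonempty by blast
  have "card (blocked f) \<le> card (avail S2 f L x)"
    using x in_V nb_blocked(1)[OF f x]
    by (intro card_inj_on_le[OF inj_nb_blocked[OF f x]] finite_avail) blast+
  then show ?thesis using card_avail_eq[OF f c x] by simp
qed simp

lemma avail_eq_nb_blocked:
  assumes f: "col S2 L f" and full: "card (blocked f) = card S1" and x: "x \<in> S1"
  shows "nb x ` blocked f = avail S2 f L x"
proof -
  obtain c where c: "c \<in> blocked f" using full card_pos by fastforce
  have "x \<in> V" using x in_V by blast
  moreover have "nb x ` blocked f \<subseteq> avail S2 f L x" using nb_blocked(1)[OF f x] by blast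
  moreover have "card (nb x ` blocked f) = card (avail S2 f L x)"
    using card_avail_eq[OF f c x] full card_image[OF inj_nb_blocked[OF f x]] by simp
  ultimately show ?thesis by (intro card_subset_eq finite_avail)
qed

text \<open>If \<open>z\<close> takes a blocked colour \<open>c1\<close> other than
  \<open>c\<close>, then \<open>d\<close> stays free at \<open>x\<close>, and the failure to colour
  \<open>S1\<close> forces a partner \<open>e\<close> of \<open>d\<close> at \<open>x'\<close> that
  is not matched to \<open>c1\<close>. Since \<open>e\<close> is the same for all such
  \<open>c1\<close> and is matched to some blocked colour, that colour can only be
  \<open>c\<close>.\<close>

lemma S1_nb_agree:
  assumes f: "col S2 L f" and full: "card (blocked f) = card S1"
    and xx': "x \<in> S1" "x' \<in> S1" "x \<noteq> x'" and c: "c \<in> blocked f"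
    and d: "d \<in> L x" "d' \<in> L x'" "R c d" "R c d'"
  shows "R d d'"
proof -
  have sub: "blocked f \<subseteq> L z" by (auto simp: blocked_def)
  have V: "x \<in> V" "x' \<in> V" "z \<in> V" "z \<noteq> x" "z \<noteq> x'" using xx' in_V dis by auto
  have dx: "d \<in> avail S2 f L x"
    using blocked_nb[OF f c xx'(1)] R_matching[of z x c d] V d sub c by (auto simp: avail_def)
  have step: "\<exists>e \<in> lists f c1 x'. R d e" if c1: "c1 \<in> blocked f" "c1 \<noteq> c" for c1
  proof (rule clique_perfect[OF in_V(1) lists_subset(2) _ _ xx'])
    show "card S1 \<le> Suc (card (lists f c1 v))" if "v \<in> S1" for v
      using lists_tight[OF f c1(1) that] by simp
    show "\<nexists>g. col S1 (lists f c1) g" using c1 by (auto simp: blocked_def)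
    have "\<not> R c1 d" using R_matching[of x z d c1 c] V d sub c c1 R_sym by blast
    then show "d \<in> lists f c1 x" using dx by (auto simp: lists_def avail_def)
  qed
  \<comment> \<open>A second blocked colour exists because \<open>x\<close> and \<open>x'\<close>
    make \<open>card S1\<close> at least 2.\<close>
  have "\<not> blocked f \<subseteq> {c}"
  proof
    assume "blocked f \<subseteq> {c}"
    then have "card (blocked f) \<le> card {c}" by (intro card_mono) auto
    moreover have "card {x, x'} \<le> card S1" using xx' fin by (intro card_mono) auto
    ultimately show False using full xx' by simp
  qed
  then obtain c1 where c1: "c1 \<in> blocked f" "c1 \<noteq> c" by blast
  then obtain e where e: "e \<in> lists f c1 x'" "R d e" using step by blast
  then have "e \<in> avail S2 f L x'" "e \<in> L x'" using lists_subset by blast+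
  then obtain c2 where c2: "c2 \<in> blocked f" "e = nb x' c2"
    using avail_eq_nb_blocked[OF f full xx'(2)] by blast
  then have "R c2 e" using nb_blocked(2)[OF f xx'(2)] by simp
  have "c2 = c"
  proof (rule ccontr)
    assume "c2 \<noteq> c"
    then obtain e' where e': "e' \<in> lists f c2 x'" "R d e'" using step c2(1) by blast
    then have "e' = e" using R_matching[of x x' d e' e] V xx' d e lists_subset by blast
    then show False using e' \<open>R c2 e\<close> by (auto simp: lists_def avail_def)
  qed
  then have "e = d'" using R_matching[of z x' c e d'] V d c sub \<open>R c2 e\<close> \<open>e \<in> L x'\<close> by blast
  then show ?thesis using e by simp
qed

text \<open>Colouring \<open>z\<close> by \<open>c\<close> leaves the lists of \<open>S2\<close>
  untouched, so a vertex of \<open>S2\<close> supplies the slack for a greedy colouring of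
  \<open>S1 \<union> S2\<close>.\<close>

lemma not_blocked_exists:
  assumes c: "c \<in> L z"
  shows "\<exists>h. col S2 L h \<and> c \<notin> blocked h"
proof -
  let ?M = "avail {z} (\<lambda>_. c) L"
  obtain v where v: "v \<in> S2" using nonempty by blast
  have cS: "card (S1 \<union> S2) = m" using card_S card_Un_disjoint fin dis by metis
  have "?M v = L v" using z_S2[OF c v] by (auto simp: avail_def)
  then have "card (S1 \<union> S2) \<le> card (?M v)" using card_L[of v] v in_V cS by auto
  moreover have "card (S1 \<union> S2) \<le> Suc (card (?M w))" if w: "w \<in> S1 \<union> S2" for w
  proof -
    have "card (L w) \<le> Suc (card (?M w))"
      using that in_V dis c by (intro card_avail1) auto
    moreover have "w \<in> V" using w in_V by blast
    ultimately show ?thesis using card_L[of w] cS by simp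
  qed
  ultimately have "\<exists>h. col (S1 \<union> S2) ?M h"
    using v in_V by (intro greedy_slack[of _ _ v] avail_subset) auto
  then obtain h where h: "col (S1 \<union> S2) ?M h" by blast
  have "h x \<in> lists h c x" if "x \<in> S1" for x
  proof -
    have "\<not> R (h u) (h x)" if "u \<in> S2" for u
    proof -
      have "u \<noteq> x" using that \<open>x \<in> S1\<close> dis by blast
      then show ?thesis using h that \<open>x \<in> S1\<close> unfolding col_def by blast
    qed
    then show ?thesis using that h by (auto simp: lists_def col_def avail_def)
  qed
  then have "col S1 (lists h c) h" using h by (auto simp: col_def)
  moreover have "col S2 L h" using h by (auto simp: col_def avail_def)
  ultimately show ?thesis by (auto simp: blocked_def)
qed

lemma col_combine:
  assumes f: "col S2 L f" and g: "col S1 (lists f c) g" and c: "c \<in> L z"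
  shows "col (insert z (S1 \<union> S2)) L (\<lambda>v. if v = z then c else if v \<in> S1 then g v else f v)"
    (is "col _ L ?F")
proof -
  have "col (S1 \<union> S2) L (\<lambda>v. if v \<in> S1 then g v else f v)" (is "col _ L ?G")
    unfolding col_def
  proof (intro conjI ballI impI)
    fix v assume "v \<in> S1 \<union> S2"
    then show "?G v \<in> L v" using f g lists_subset(2)[of f c v] by (auto simp: col_def)
  next
    have 12: "\<not> R (f u) (g v)" if "u \<in> S2" "v \<in> S1" for u v
      using g that by (auto simp: col_def lists_def avail_def)
    then have 21: "\<not> R (g v) (f u)" if "u \<in> S2" "v \<in> S1" for u v
      using that R_sym[of "g v" "f u"] by blast
    fix u v assume "u \<in> S1 \<union> S2" "v \<in> S1 \<union> S2" "u \<noteq> v"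
    then show "\<not> R (?G u) (?G v)"
      using f g 12 21 unfolding col_def by auto
  qed
  moreover have "\<not> R (?G u) c" if "u \<in> S1 \<union> S2" for u
  proof
    assume "R (?G u) c"
    then have "R c (?G u)" by (rule R_sym)
    then show False using that z_S2[OF c, of u "f u"] f g
      by (auto simp: col_def lists_def avail_def split: if_splits)
  qed
  ultimately have "col (insert z (S1 \<union> S2)) L (?G(z := c))"
    using dis c by (intro col_insert) auto
  moreover have "?G(z := c) = ?F" by auto
  ultimately show ?thesis by simp
qed

end

section \<open>Gluing the two cliques\<close>

locale E_cover = X: half_cover V L R X1 X2 z m + Y: half_cover V L R Y1 Y2 z m
  for V :: "'a set" and L :: "'a \<Rightarrow> 'c set" and R X1 X2 Y1 Y2 z m +
  assumes V_eq: "V = insert z (X1 \<union> X2 \<union> (Y1 \<union> Y2))"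
    and dis_XY: "(X1 \<union> X2) \<inter> (Y1 \<union> Y2) = {}"
    and card_ge: "m \<le> card X1 + card Y1"
    and nonadj: "\<lbrakk>x \<in> X1 \<union> X2; y \<in> Y1 \<union> Y2; \<not> (x \<in> X2 \<and> y \<in> Y2); c \<in> L x; d \<in> L y\<rbrakk> \<Longrightarrow> \<not> R c d"
    and nocol: "\<nexists>f. X.col V L f"
begin

text \<open>The hypotheses are symmetric in the two sides; interpreting the swapped instance turns
  each fact about the \<open>X\<close> side into its counterpart for the \<open>Y\<close>
  side.\<close>

lemma swap: "E_cover V L R Y1 Y2 X1 X2 z m"
proof unfold_locales
  show "V = insert z (Y1 \<union> Y2 \<union> (X1 \<union> X2))" "(Y1 \<union> Y2) \<inter> (X1 \<union> X2) = {}"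
    "m \<le> card Y1 + card X1" "\<nexists>f. X.col V L f"
    using V_eq dis_XY card_ge nocol by auto
  show "\<not> R c d" if "x \<in> Y1 \<union> Y2" "y \<in> X1 \<union> X2" "\<not> (x \<in> Y2 \<and> y \<in> X2)" "c \<in> L x" "d \<in> L y"
    for x y c d
    using nonadj[of y x d c] X.R_sym[of c d] that by blast
qed

text \<open>If \<open>c\<close> were blocked on neither side, both halves would extend around it,
  and together they would colour everything: the only possible conflicts across are between
  \<open>X2\<close> and \<open>Y2\<close>, and \<open>fh\<close> excludes them.\<close>

lemma glue:
  assumes f: "X.col X2 L f" and h: "X.col Y2 L h" and c: "c \<in> L z" "c \<notin> X.blocked f"
    and fh: "\<And>x y. x \<in> X2 \<Longrightarrow> y \<in> Y2 \<Longrightarrow> \<not> R (f x) (h y)"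
  shows "c \<in> Y.blocked h"
proof (rule ccontr)
  assume "c \<notin> Y.blocked h"
  then obtain g' where g': "X.col Y1 (Y.lists h c) g'" using c by (auto simp: Y.blocked_def)
  obtain g where g: "X.col X1 (X.lists f c) g" using c by (auto simp: X.blocked_def)
  define F where "F = (\<lambda>v. if v = z then c else if v \<in> X1 then g v else f v)"
  define G where "G = (\<lambda>v. if v = z then c else if v \<in> Y1 then g' v else h v)"
  define H where "H = (\<lambda>v. if v \<in> X1 \<union> X2 then F v else G v)"
  have "H v = F v" if "v \<in> insert z (X1 \<union> X2)" for v
    using that by (auto simp: F_def G_def H_def)
  moreover have "X.col (insert z (X1 \<union> X2)) L F"
    unfolding F_def by (rule X.col_combine[OF f g c(1)])
  ultimately have colX: "X.col (insert z (X1 \<union> X2)) L H" using X.col_cong by metis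
  have "H v = G v" if "v \<in> insert z (Y1 \<union> Y2)" for v
    using that dis_XY X.dis by (auto simp: F_def G_def H_def)
  moreover have "X.col (insert z (Y1 \<union> Y2)) L G"
    unfolding G_def by (rule Y.col_combine[OF h g' c(1)])
  ultimately have colY: "X.col (insert z (Y1 \<union> Y2)) L H" using X.col_cong by metis
  have cross: "\<not> R (H x) (H y)" if xy: "x \<in> X1 \<union> X2" "y \<in> Y1 \<union> Y2" for x y
  proof (cases "x \<in> X2 \<and> y \<in> Y2")
    case True
    then have "H x = f x" "H y = h y"
      using X.dis Y.dis dis_XY by (auto simp: F_def G_def H_def)
    then show ?thesis using fh True by simp
  next
    case False
    have "H x \<in> L x" "H y \<in> L y" using colX colY xy unfolding X.col_def by blast+
    then show ?thesis using nonadj[OF xy False] by blast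
  qed
  have "X.col V L H"
    unfolding X.col_def
  proof (intro conjI ballI impI)
    fix v assume "v \<in> V"
    then show "H v \<in> L v" using colX colY unfolding X.col_def V_eq by blast
  next
    fix u v assume uv: "u \<in> V" "v \<in> V" "u \<noteq> v"
    then consider "u \<in> insert z (X1 \<union> X2)" "v \<in> insert z (X1 \<union> X2)"
      | "u \<in> insert z (Y1 \<union> Y2)" "v \<in> insert z (Y1 \<union> Y2)"
      | "u \<in> X1 \<union> X2" "v \<in> Y1 \<union> Y2" | "v \<in> X1 \<union> X2" "u \<in> Y1 \<union> Y2"
      unfolding V_eq by blast
    then show "\<not> R (H u) (H v)"
    proof cases
      case 1 then show ?thesis using colX uv(3) unfolding X.col_def by blast
    next
      case 2 then show ?thesis using colY uv(3) unfolding X.col_def by blast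
    next
      case 3 then show ?thesis by (rule cross)
    next
      case 4 then show ?thesis using cross[OF 4] X.R_sym by blast
    qed
  qed
  then show False using nocol by blast
qed

text \<open>The colours on \<open>X2\<close> leave at least \<open>m - card X2 = card X1\<close>
  colours at each vertex of \<open>Y2\<close>, and by \<open>card_ge\<close> these are at least
  \<open>card Y2\<close>, enough for greedy colouring with a prescribed \<open>q\<close>.\<close>

lemma extend_compatible:
  assumes f: "X.col X2 L f" and v: "v \<in> Y2" and q: "q \<in> X.avail X2 f L v"
  shows "\<exists>h. X.col Y2 L h \<and> h v = q \<and> (\<forall>x\<in>X2. \<forall>y\<in>Y2. \<not> R (f x) (h y))"
proof -
  have "card Y2 \<le> card (X.avail X2 f L w)" if w: "w \<in> Y2" for w
  proof -
    have "card (L w) \<le> card (X.avail X2 f L w) + card X2"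
      using w f X.in_V Y.in_V dis_XY by (intro X.card_avail) (auto simp: X.col_def)
    moreover have "card (L w) = m" using X.card_L w Y.in_V by blast
    ultimately show ?thesis using X.card_S Y.card_S card_ge by linarith
  qed
  then have "\<exists>h. X.col Y2 (X.avail X2 f L) h \<and> h v = q"
    using v q Y.in_V X.avail_subset by (intro X.greedy_extend) auto
  then show ?thesis by (auto simp: X.col_def X.avail_def)
qed

text \<open>If \<open>c \<in> L z\<close> is not blocked by \<open>f\<close>, then it is blocked by every colouring of \<open>Y2\<close> that is
  compatible with \<open>f\<close>; such a colouring may use any available \<open>q \<in> L v\<close>, which therefore does
  not rule out the same colour of \<open>y\<close> as \<open>c\<close>.  Thus the two sets of colours have disjoint
  neighbourhoods in \<open>L y\<close>, and counting leaves no slack.\<close>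

lemma counting:
  assumes f: "X.col X2 L f" and y: "y \<in> Y1" and v: "v \<in> Y2"
  shows "card (X.blocked f) = card X1" "card (X.avail X2 f L v) = card X1"
    "card (L z - X.blocked f) = card X2"
    "\<And>c q d. \<lbrakk>c \<in> L z - X.blocked f; q \<in> X.avail X2 f L v; d \<in> L y; R c d\<rbrakk> \<Longrightarrow> \<not> R q d"
proof -
  let ?W = "L z - X.blocked f" and ?U = "X.avail X2 f L v"
  have V: "v \<in> V" "y \<in> V" "z \<in> V" "y \<noteq> z" "y \<noteq> v" using y v Y.in_V Y.dis by auto
  have cLv: "card (L v) = m" "card (L z) = m" "card (L y) = m" using V X.card_L by auto
  have "card (L v) \<le> card ?U + card X2"
    using v f X.in_V Y.in_V dis_XY by (intro X.card_avail) (auto simp: X.col_def)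
  then have cU: "card X1 \<le> card ?U" using cLv X.card_S by linarith
  have cW: "card ?W = m - card (X.blocked f)"
    using cLv X.blocked_subset X.finite_L[OF V(3)] by (metis card_Diff_subset finite_subset)
  have cB: "card (X.blocked f) \<le> card X1" by (rule X.card_blocked_le[OF f])
  then have cW': "card X2 \<le> card ?W" using cW X.card_S by linarith
  have main: "(\<exists>d\<in>L y. R c d) \<and> (\<exists>d\<in>L y. R q d) \<and>
      (\<forall>d\<in>L y. R c d \<longrightarrow> \<not> R q d)"
    if c: "c \<in> ?W" and q: "q \<in> ?U" for c q
  proof -
    obtain h where h: "X.col Y2 L h" "h v = q" "\<forall>x\<in>X2. \<forall>y\<in>Y2. \<not> R (f x) (h y)"
      using extend_compatible[OF f v q] by blast
    have cb: "c \<in> Y.blocked h" using glue[OF f h(1)] h(3) c by blast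
    obtain d where d: "d \<in> X.avail Y2 h L y" "R c d" using Y.blocked_nb[OF h(1) cb y] by blast
    have "\<not> R q d" "d \<in> L y" using d(1) v h(2) by (auto simp: X.avail_def)
    then have "\<forall>d\<in>L y. R c d \<longrightarrow> \<not> R q d"
      using X.R_matching[OF V(3,2), of c d] V c d(2) by blast
    moreover have "\<exists>d\<in>L y. R q d" using Y.blocked_S2_nb[OF h(1) cb y v] h(2) by simp
    ultimately show ?thesis using d \<open>d \<in> L y\<close> by blast
  qed
  show sep: "\<not> R q d" if "c \<in> ?W" "q \<in> ?U" "d \<in> L y" "R c d" for c q d
    using main[OF that(1,2)] that(3,4) by blast
  \<comment> \<open>The previous facts concern pairs; a fixed member of each set yields partners in
    \<open>L y\<close> for every member of the other.\<close>
  obtain c0 where c0: "c0 \<in> ?W" using cW' X.card_pos by (metis all_not_in_conv card.empty not_le)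
  obtain q0 where q0: "q0 \<in> ?U" using cU X.card_pos by (metis all_not_in_conv card.empty not_le)
  have W: "\<exists>d\<in>L y. R c d" if "c \<in> ?W" for c using main[OF that q0] by blast
  have U: "\<exists>d\<in>L y. R q d" if "q \<in> ?U" for q using main[OF c0 that] by blast
  have "inj_on (X.nb y) ?W" using V by (intro X.inj_on_nb[OF V(3,2)] W) auto
  then have iW: "card (X.nb y ` ?W) = card ?W" by (rule card_image)
  have "inj_on (X.nb y) ?U" using V X.avail_subset by (intro X.inj_on_nb[OF V(1,2)] U) auto
  then have iU: "card (X.nb y ` ?U) = card ?U" by (rule card_image)
  have "X.nb y ` ?W \<inter> X.nb y ` ?U = {}"
  proof (rule ccontr)
    assume "\<not> ?thesis"
    then obtain c q where cq: "c \<in> ?W" "q \<in> ?U" "X.nb y c = X.nb y q" by auto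
    show False
      using sep[OF cq(1,2) X.nb_ex[OF W[OF cq(1)]]] X.nb_ex(2)[OF U[OF cq(2)]] cq(3) by simp
  qed
  moreover have sub: "X.nb y ` ?W \<union> X.nb y ` ?U \<subseteq> L y" using X.nb_ex(1) W U by blast
  moreover have "finite (L y)" using X.finite_L V by blast
  ultimately have "card (X.nb y ` ?W \<union> X.nb y ` ?U) = card (X.nb y ` ?W) + card (X.nb y ` ?U)"
    "card (X.nb y ` ?W \<union> X.nb y ` ?U) \<le> card (L y)"
    by (auto intro!: card_Un_disjoint card_mono intro: finite_subset)
  then have "card (X.nb y ` ?W) + card (X.nb y ` ?U) \<le> m" using cLv(3) by simp
  then have "card ?W + card ?U \<le> card X1 + card X2" using iW iU X.card_S by simp
  then show "card ?W = card X2" "card ?U = card X1" using cU cW' by linarith+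
  then show "card (X.blocked f) = card X1" using cW cB X.card_S by linarith
qed

lemma ex_col: "u \<in> X2 \<Longrightarrow> p \<in> L u \<Longrightarrow> \<exists>f. X.col X2 L f \<and> f u = p"
  using X.in_V X.card_L X.card_S by (intro X.greedy_extend) auto

text \<open>Equality in the count means that every vertex of \<open>X2\<close> really removes a
  colour from \<open>L v\<close>; and every \<open>p\<close> occurs in some colouring of
  \<open>X2\<close>.\<close>

lemma perf_X2_Y2:
  assumes u: "u \<in> X2" and v: "v \<in> Y2"
  shows "X.perf u v"
  unfolding X.perf_def
proof (rule ballI, rule ccontr)
  fix p assume p: "p \<in> L u" and neg: "\<not> (\<exists>q\<in>L v. R p q)"
  obtain f where f: "X.col X2 L f" "f u = p" using ex_col[OF u p] by blast
  obtain y where y: "y \<in> Y1" using Y.nonempty by blast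
  have "X.avail (X2 - {u}) f L v = X.avail X2 f L v" using neg f(2) by (auto simp: X.avail_def)
  then have "card (X.avail (X2 - {u}) f L v) = card X1" using counting(2)[OF f(1) y v] by simp
  moreover have "card (L v) \<le> card (X.avail (X2 - {u}) f L v) + card (X2 - {u})"
    using v f X.in_V Y.in_V dis_XY by (intro X.card_avail) (auto simp: X.col_def)
  moreover have "card X2 = Suc (card (X2 - {u}))" using X.fin u by (metis card_Suc_Diff1)
  moreover have "card (L v) = m" using X.card_L v Y.in_V by blast
  ultimately show False using X.card_S by linarith
qed

lemma card_blocked: "X.col X2 L f \<Longrightarrow> card (X.blocked f) = card X1"
  using counting(1) Y.nonempty by blast

lemma card_unblocked: "X.col X2 L f \<Longrightarrow> card (L z - X.blocked f) = card X2"
  using counting(3) Y.nonempty by blast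

text \<open>Every \<open>p\<close> occurs in a colouring of \<open>X2\<close>, which blocks
  \<open>card X1 > 0\<close> colours; a single blocked colour already forces the partner.\<close>

lemma perf_X2_X1:
  assumes u: "u \<in> X2" and x: "x \<in> X1"
  shows "X.perf u x"
  unfolding X.perf_def
proof
  fix p assume "p \<in> L u"
  then obtain f where f: "X.col X2 L f" "f u = p" using ex_col[OF u] by blast
  then have "card (X.blocked f) \<noteq> 0" using card_blocked X.card_pos by simp
  then obtain c where "c \<in> X.blocked f" by (metis all_not_in_conv card.empty)
  then show "\<exists>d\<in>L x. R p d" using X.blocked_S2_nb[OF f(1) _ x u] f(2) by simp
qed

text \<open>Some colouring of \<open>Y2\<close> does not block \<open>c\<close>; any compatible
  colouring of \<open>X2\<close> then must.\<close>

lemma ex_blocked: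
  assumes c: "c \<in> L z"
  shows "\<exists>f. X.col X2 L f \<and> c \<in> X.blocked f"
proof -
  interpret swap: E_cover V L R Y1 Y2 X1 X2 z m by (rule swap)
  obtain h where h: "X.col Y2 L h" "c \<notin> Y.blocked h" using Y.not_blocked_exists[OF c] by blast
  obtain u x where u: "u \<in> X2" "x \<in> X1" using X.nonempty by blast
  have "card (X.avail Y2 h L u) \<noteq> 0" using swap.counting(2)[OF h(1) u(2,1)] Y.card_pos by simp
  then obtain p where "p \<in> X.avail Y2 h L u" by (metis all_not_in_conv card.empty)
  then obtain f where f: "X.col X2 L f" "\<forall>x\<in>Y2. \<forall>y\<in>X2. \<not> R (h x) (f y)"
    using swap.extend_compatible[OF h(1) u(1)] by blast
  then show ?thesis using swap.glue[OF h(1) f(1) c h(2)] by blast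
qed

lemma perf_z_X1:
  assumes x: "x \<in> X1"
  shows "X.perf z x"
  unfolding X.perf_def
proof
  fix c assume "c \<in> L z"
  then obtain f where "X.col X2 L f" "c \<in> X.blocked f" using ex_blocked by blast
  then show "\<exists>d\<in>L x. R c d" using X.blocked_nb x X.avail_subset by blast
qed

text \<open>In \<open>L x\<close> the partners of the blocked colours are exactly the colours left
  free by \<open>f\<close>. So the partner of an unblocked colour is removed by some
  \<open>f u\<close>, which gives one inclusion; the image has at most \<open>card X2\<close>
  elements, which gives equality.\<close>

lemma labels_X:
  assumes f: "X.col X2 L f" and x: "x \<in> X1"
  shows "(\<lambda>u. X.nb z (X.nb x (f u))) ` X2 = L z - X.blocked f"
proof (rule sym, rule card_seteq)
  show "finite ((\<lambda>u. X.nb z (X.nb x (f u))) ` X2)" using X.fin by simp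
  show "card ((\<lambda>u. X.nb z (X.nb x (f u))) ` X2) \<le> card (L z - X.blocked f)"
    using card_unblocked[OF f] X.fin card_image_le by metis
  have V: "z \<in> V" "x \<in> V" "z \<noteq> x" using x X.in_V X.dis by auto
  note pf = perf_z_X1[OF x]
  show "L z - X.blocked f \<subseteq> (\<lambda>u. X.nb z (X.nb x (f u))) ` X2"
  proof
    fix c assume c: "c \<in> L z - X.blocked f"
    let ?d = "X.nb x c"
    have d: "?d \<in> L x" using X.nb_in[OF pf] c by blast
    have "?d \<notin> X.nb x ` X.blocked f"
      using c inj_on_image_mem_iff[OF X.inj_nb[OF V pf] _ X.blocked_subset] by blast
    then have "?d \<notin> X.avail X2 f L x"
      using X.avail_eq_nb_blocked[OF f card_blocked[OF f] x] by simp
    then obtain u where u: "u \<in> X2" "R (f u) ?d" using d by (auto simp: X.avail_def)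
    then have "X.nb x (f u) = ?d"
      using d f x V X.in_V X.dis by (intro X.nb_eq[of u]) (auto simp: X.col_def)
    moreover have "X.nb z ?d = c" using X.nb_nb[OF V pf] c by blast
    ultimately show "c \<in> (\<lambda>u. X.nb z (X.nb x (f u))) ` X2" using u(1) by force
  qed
qed

lemma perf_X1_X2:
  assumes "x \<in> X1" "u \<in> X2"
  shows "X.perf x u"
proof -
  have "u \<in> V" "x \<in> V" "u \<noteq> x" using assms X.in_V X.dis by auto
  then show ?thesis using X.perf_sym[OF _ _ _ perf_X2_X1] assms X.card_L by metis
qed

lemma perf_X1_z:
  assumes "x \<in> X1"
  shows "X.perf x z"
proof -
  have "z \<in> V" "x \<in> V" "z \<noteq> x" using assms X.in_V X.dis by auto
  then show ?thesis using X.perf_sym[OF _ _ _ perf_z_X1] assms X.card_L by metis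
qed

text \<open>Follow an unblocked \<open>c\<close> to its partner in \<open>L y\<close> and on to a
  colour \<open>q\<close> of \<open>v\<close>. Were \<open>q\<close> left free by \<open>f\<close>,
  it would share a partner in \<open>L y\<close> with \<open>c\<close>, which
  \<open>counting\<close> excludes; hence some \<open>f u\<close> is matched to
  \<open>q\<close>.\<close>

lemma labels_Y:
  assumes f: "X.col X2 L f" and y: "y \<in> Y1" and v: "v \<in> Y2"
  shows "(\<lambda>u. X.nb z (X.nb y (X.nb v (f u)))) ` X2 = L z - X.blocked f"
proof (rule sym, rule card_seteq)
  interpret swap: E_cover V L R Y1 Y2 X1 X2 z m by (rule swap)
  show "finite ((\<lambda>u. X.nb z (X.nb y (X.nb v (f u)))) ` X2)" using X.fin by simp
  show "card ((\<lambda>u. X.nb z (X.nb y (X.nb v (f u)))) ` X2) \<le> card (L z - X.blocked f)"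
    using card_unblocked[OF f] X.fin card_image_le by metis
  have V: "z \<in> V" "y \<in> V" "z \<noteq> y" "v \<in> V" "y \<noteq> v" using y v Y.in_V Y.dis by auto
  note zy = swap.perf_z_X1[OF y] and yv = swap.perf_X1_X2[OF y v]
  show "L z - X.blocked f \<subseteq> (\<lambda>u. X.nb z (X.nb y (X.nb v (f u)))) ` X2"
  proof
    fix c assume c: "c \<in> L z - X.blocked f"
    let ?d = "X.nb y c" and ?q = "X.nb v (X.nb y c)"
    have d: "?d \<in> L y" "R c ?d" using X.nb_in[OF zy] X.nb_R[OF zy] c by blast+
    have q: "?q \<in> L v" "R ?q ?d" using X.nb_in[OF yv] X.R_sym[OF X.nb_R[OF yv]] d by blast+
    then have "?q \<notin> X.avail X2 f L v" using counting(4)[OF f y v c _ d] by blast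
    then obtain u where u: "u \<in> X2" "R (f u) ?q" using q by (auto simp: X.avail_def)
    then have "X.nb v (f u) = ?q"
      using q f v V X.in_V dis_XY by (intro X.nb_eq[of u]) (auto simp: X.col_def)
    moreover have "X.nb z ?d = c" "X.nb y ?q = ?d"
      using X.nb_nb[OF V(1-3) zy] X.nb_nb[OF V(2,4,5) yv] c d by blast+
    ultimately show "c \<in> (\<lambda>u. X.nb z (X.nb y (X.nb v (f u)))) ` X2" using u(1) by force
  qed
qed

section \<open>Consistency of the labels, and adjacency of colours with equal labels\<close>

lemma bij_X1:
  assumes "x \<in> X1"
  shows "bij_betw (X.nb z) (L x) (L z)"
proof -
  have "z \<in> V" "x \<in> V" "x \<noteq> z" using assms X.in_V X.dis by auto
  then show ?thesis using X.bij_nb[OF _ _ _ perf_X1_z[OF assms]] X.card_L by metis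
qed

lemma bij_X2_X1:
  assumes "u \<in> X2" "x \<in> X1"
  shows "bij_betw (X.nb x) (L u) (L x)"
proof -
  have "u \<in> V" "x \<in> V" "u \<noteq> x" using assms X.in_V X.dis by auto
  then show ?thesis using X.bij_nb[OF _ _ _ perf_X2_X1[OF assms]] X.card_L by metis
qed

lemma bij_X2: "u \<in> X2 \<Longrightarrow> x \<in> X1 \<Longrightarrow> bij_betw (\<lambda>p. X.nb z (X.nb x p)) (L u) (L z)"
  using bij_betw_trans[OF bij_X2_X1 bij_X1] by (simp add: comp_def)

text \<open>Both detours send every colouring \<open>f\<close> of \<open>X2\<close> onto the colours
  not blocked by \<open>f\<close>, and \<open>labels_agree\<close> passes from sets of labels to
  single labels. As \<open>X1\<close> is nonempty, the lists are longer than \<open>card X2\<close>,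
  as required there.\<close>

lemma labels_X_eq_Y:
  assumes "u \<in> X2" "p \<in> L u" "x \<in> X1" "y \<in> Y1" "v \<in> Y2"
  shows "X.nb z (X.nb x p) = X.nb z (X.nb y (X.nb v p))"
proof (rule X.labels_agree[of X2 "\<lambda>_ p. X.nb z (X.nb x p)" u "\<lambda>_ p. X.nb z (X.nb y (X.nb v p))"])
  show "X2 \<subseteq> V" by (rule X.in_V)
  show "card X2 < card (L w)" if "w \<in> X2" for w
  proof -
    have "w \<in> V" using that X.in_V by blast
    then show ?thesis using X.card_L X.card_S X.card_pos by simp
  qed
  show "inj_on (\<lambda>p. X.nb z (X.nb x p)) (L u)"
    using bij_X2 assms by (simp add: bij_betw_def)
  show "(\<lambda>u. X.nb z (X.nb x (f u))) ` X2 = (\<lambda>u. X.nb z (X.nb y (X.nb v (f u)))) ` X2"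
    if "X.col X2 L f" for f
    using that labels_X labels_Y assms by simp
  show "card ((\<lambda>u. X.nb z (X.nb x (f u))) ` X2) = card X2" if "X.col X2 L f" for f
    using that labels_X card_unblocked assms by simp
qed (use assms in auto)

text \<open>Both sides equal the label found by one and the same detour through the \<open>Y\<close>
  side.\<close>

lemma labels_X_eq:
  assumes "u \<in> X2" "p \<in> L u" "x \<in> X1" "x' \<in> X1"
  shows "X.nb z (X.nb x p) = X.nb z (X.nb x' p)"
proof -
  obtain y v where "y \<in> Y1" "v \<in> Y2" using Y.nonempty by blast
  then show ?thesis using labels_X_eq_Y assms by metis
qed

lemma adj_z_X1:
  assumes "x \<in> X1" "d \<in> L x"
  shows "R (X.nb z d) d"
  using X.R_sym[OF X.nb_R[OF perf_X1_z]] assms by blast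

text \<open>Some colouring of \<open>X2\<close> blocks the common label, and it blocks the full
  number \<open>card X1\<close> of colours, so \<open>S1_nb_agree\<close> applies.\<close>

lemma adj_X1_X1:
  assumes x: "x \<in> X1" "x' \<in> X1" "x \<noteq> x'" and d: "d \<in> L x" "d' \<in> L x'"
    and eq: "X.nb z d = X.nb z d'"
  shows "R d d'"
proof -
  have "X.nb z d \<in> L z" using X.nb_in[OF perf_X1_z] x d by blast
  then obtain f where f: "X.col X2 L f" "X.nb z d \<in> X.blocked f" using ex_blocked by blast
  show ?thesis
    using X.S1_nb_agree[OF f(1) card_blocked[OF f(1)] x f(2) d]
      adj_z_X1[OF x(1) d(1)] adj_z_X1[OF x(2) d(2)] eq by simp
qed

lemma adj_X2_X1:
  assumes u: "u \<in> X2" "p \<in> L u" and x: "x \<in> X1" "x' \<in> X1" "d \<in> L x"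
    and eq: "X.nb z (X.nb x' p) = X.nb z d"
  shows "R p d"
proof -
  have pf: "X.perf u x" using perf_X2_X1 u x by blast
  have "X.nb z (X.nb x p) = X.nb z d" using labels_X_eq[OF u x(1,2)] eq by simp
  then have "X.nb x p = d"
    using bij_X1[OF x(1)] X.nb_in[OF pf u(2)] x(3) by (auto simp: bij_betw_def inj_on_def)
  then show ?thesis using X.nb_R[OF pf u(2)] by simp
qed

text \<open>Two unmatched colours with equal labels could be used in one colouring of
  \<open>X2\<close>, whose set of labels would then have fewer than \<open>card X2\<close>
  elements.\<close>

lemma adj_X2_X2:
  assumes u: "u \<in> X2" "u' \<in> X2" "u \<noteq> u'" and p: "p \<in> L u" "p' \<in> L u'" and x: "x \<in> X1"
    and eq: "X.nb z (X.nb x p) = X.nb z (X.nb x p')"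
  shows "R p p'"
proof (rule ccontr)
  assume "\<not> R p p'"
  moreover have "card X2 \<le> card (L w)" if "w \<in> X2" for w
  proof -
    have "w \<in> V" using that X.in_V by blast
    then show ?thesis using X.card_L X.card_S by simp
  qed
  ultimately obtain f where f: "X.col X2 L f" "f u = p" "f u' = p'"
    using X.greedy_extend2[of X2 L u u' p p'] X.in_V u p by blast
  have "card ((\<lambda>u. X.nb z (X.nb x (f u))) ` X2) = card X2"
    using f labels_X card_unblocked x by simp
  then have "inj_on (\<lambda>u. X.nb z (X.nb x (f u))) X2" using X.fin eq_card_imp_inj_on by blast
  then show False using u f eq by (auto simp: inj_on_def)
qed

lemma adj_X2_Y2:
  assumes u: "u \<in> X2" "p \<in> L u" and v: "v \<in> Y2" "q \<in> L v" and x: "x \<in> X1" and y: "y \<in> Y1"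
    and eq: "X.nb z (X.nb x p) = X.nb z (X.nb y q)"
  shows "R p q"
proof -
  interpret swap: E_cover V L R Y1 Y2 X1 X2 z m by (rule swap)
  have pf: "X.perf u v" using perf_X2_Y2 u v by blast
  have "X.nb z (X.nb y (X.nb v p)) = X.nb z (X.nb y q)" using labels_X_eq_Y[OF u x y v(1)] eq by simp
  then have "X.nb v p = q"
    using swap.bij_X2[OF v(1) y] X.nb_in[OF pf u(2)] v(2) by (auto simp: bij_betw_def inj_on_def)
  then show ?thesis using X.nb_R[OF pf u(2)] by simp
qed

lemma ex_labelling:
  "\<exists>lab. (\<forall>v\<in>V. bij_betw (lab v) (L v) (L z)) \<and>
     (\<forall>u v. {u, v} \<in> edges (E_graph X1 X2 Y1 Y2 z) \<longrightarrow>
        (\<forall>c\<in>L u. \<forall>d\<in>L v. R c d \<longleftrightarrow> lab u c = lab v d))"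
proof -
  interpret swap: E_cover V L R Y1 Y2 X1 X2 z m by (rule swap)
  obtain x0 y0 where x0: "x0 \<in> X1" and y0: "y0 \<in> Y1" using X.nonempty Y.nonempty by blast
  \<comment> \<open>The representatives \<open>x0\<close> and \<open>y0\<close> are arbitrary, since
    the label of a colour at \<open>X2\<close> or \<open>Y2\<close> does not depend on the
    detour.\<close>
  define lab where "lab = (\<lambda>v c. if v = z then c else if v \<in> X1 \<union> Y1 then X.nb z c
    else if v \<in> X2 then X.nb z (X.nb x0 c) else X.nb z (X.nb y0 c))"
  have lab_z: "lab z = id" by (auto simp: lab_def)
  have lab_1: "lab x = X.nb z" if "x \<in> X1 \<union> Y1" for x
    using that X.dis Y.dis by (auto simp: lab_def)
  have lab_X2: "lab u = (\<lambda>p. X.nb z (X.nb x0 p))" if "u \<in> X2" for u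
  proof -
    have "u \<noteq> z" "u \<notin> X1 \<union> Y1" using that X.dis dis_XY by blast+
    then show ?thesis using that by (simp add: lab_def)
  qed
  have lab_Y2: "lab u = (\<lambda>p. X.nb z (X.nb y0 p))" if "u \<in> Y2" for u
  proof -
    have "u \<noteq> z" "u \<notin> X1 \<union> Y1" "u \<notin> X2" using that Y.dis dis_XY by blast+
    then show ?thesis by (simp add: lab_def)
  qed
  have bij: "bij_betw (lab v) (L v) (L z)" if "v \<in> V" for v
    using that bij_X1 swap.bij_X1 bij_X2[OF _ x0] swap.bij_X2[OF _ y0]
    unfolding V_eq by (auto simp: lab_z lab_1 lab_X2 lab_Y2 bij_betw_id)
  \<comment> \<open>Only the passage from equal labels to adjacency is checked edge type by edge
    type; the converse is uniform and follows from the bijections.\<close>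
  define P where "P u v \<longleftrightarrow> u \<in> V \<and> v \<in> V \<and> u \<noteq> v \<and>
    (\<forall>c\<in>L u. \<forall>d\<in>L v. lab u c = lab v d \<longrightarrow> R c d)" for u v
  have P_sym: "P v u" if "P u v" for u v using that X.R_sym unfolding P_def by metis
  have z1: "P z x" if "x \<in> X1 \<union> Y1" for x
    using that adj_z_X1 swap.adj_z_X1 X.dis Y.dis unfolding P_def V_eq
    by (auto simp: lab_z lab_1)
  have X1X1: "P x x'" if "x \<in> X1" "x' \<in> X1" "x \<noteq> x'" for x x'
    using that adj_X1_X1 unfolding P_def V_eq by (auto simp: lab_1)
  have Y1Y1: "P x x'" if "x \<in> Y1" "x' \<in> Y1" "x \<noteq> x'" for x x'
    using that swap.adj_X1_X1 unfolding P_def V_eq by (auto simp: lab_1)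
  have X2X1: "P u x" if "u \<in> X2" "x \<in> X1" for u x
    using that adj_X2_X1[OF that(1) _ that(2) x0] X.dis unfolding P_def V_eq
    by (auto simp: lab_1 lab_X2)
  have Y2Y1: "P u x" if "u \<in> Y2" "x \<in> Y1" for u x
    using that swap.adj_X2_X1[OF that(1) _ that(2) y0] Y.dis unfolding P_def V_eq
    by (auto simp: lab_1 lab_Y2)
  have X2X2: "P u u'" if "u \<in> X2" "u' \<in> X2" "u \<noteq> u'" for u u'
    using that adj_X2_X2[OF that _ _ x0] unfolding P_def V_eq by (auto simp: lab_X2)
  have Y2Y2: "P u u'" if "u \<in> Y2" "u' \<in> Y2" "u \<noteq> u'" for u u'
    using that swap.adj_X2_X2[OF that _ _ y0] unfolding P_def V_eq by (auto simp: lab_Y2)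
  have X2Y2: "P u v" if "u \<in> X2" "v \<in> Y2" for u v
    using that adj_X2_Y2[OF that(1) _ that(2) _ x0 y0] dis_XY unfolding P_def V_eq
    by (auto simp: lab_X2 lab_Y2)
  have adj: "P u v" if uv: "{u, v} \<in> edges (E_graph X1 X2 Y1 Y2 z)" for u v
  proof -
    have "(u \<in> X1 \<union> X2 \<and> v \<in> X1 \<union> X2 \<and> u \<noteq> v) \<or> (u \<in> Y1 \<union> Y2 \<and> v \<in> Y1 \<union> Y2 \<and> u \<noteq> v)
      \<or> (u = z \<and> v \<in> X1 \<union> Y1) \<or> (v = z \<and> u \<in> X1 \<union> Y1)
      \<or> (u \<in> X2 \<and> v \<in> Y2) \<or> (v \<in> X2 \<and> u \<in> Y2)"
      using uv by (auto simp: E_graph_def doubleton_eq_iff)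
    then show ?thesis using z1 X1X1 Y1Y1 X2X1 Y2Y1 X2X2 Y2Y2 X2Y2 P_sym by (metis UnE)
  qed
  have "R c d \<longleftrightarrow> lab u c = lab v d"
    if uv: "{u, v} \<in> edges (E_graph X1 X2 Y1 Y2 z)" and cd: "c \<in> L u" "d \<in> L v" for u v c d
  proof
    have V: "u \<in> V" "v \<in> V" "u \<noteq> v" using adj[OF uv] by (auto simp: P_def)
    show "lab u c = lab v d \<Longrightarrow> R c d" using adj[OF uv] cd by (auto simp: P_def)
    assume "R c d"
    \<comment> \<open>Some \<open>e\<close> in \<open>L v\<close> carries the label of
      \<open>c\<close> and is therefore a partner of \<open>c\<close>; uniqueness of partners
      identifies it with \<open>d\<close>.\<close>
    have "lab u c \<in> lab v ` L v"
      using bij[OF V(1)] bij[OF V(2)] cd(1) by (auto simp: bij_betw_def)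
    then obtain e where e: "e \<in> L v" "lab u c = lab v e" by blast
    then have "R c e" using adj[OF uv] cd by (auto simp: P_def)
    then have "e = d" using X.R_matching[OF V cd(1) e(1) cd(2)] \<open>R c d\<close> by blast
    then show "lab u c = lab v d" using e by simp
  qed
  then show ?thesis using bij by blast
qed

end

section \<open>Return to the concrete graph\<close>

lemma verts_E_graph [simp]: "verts (E_graph X1 X2 Y1 Y2 z) = X1 \<union> X2 \<union> Y1 \<union> Y2 \<union> {z}"
  by (simp add: E_graph_def)

lemma edge_E_graph_iff:
  "{u, v} \<in> edges (E_graph X1 X2 Y1 Y2 z) \<longleftrightarrow>
    (u \<in> X1 \<union> X2 \<and> v \<in> X1 \<union> X2 \<and> u \<noteq> v) \<or> (u \<in> Y1 \<union> Y2 \<and> v \<in> Y1 \<union> Y2 \<and> u \<noteq> v) \<or>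
    (u = z \<and> v \<in> X1 \<union> Y1) \<or> (v = z \<and> u \<in> X1 \<union> Y1) \<or>
    (u \<in> X2 \<and> v \<in> Y2) \<or> (v \<in> X2 \<and> u \<in> Y2)"
  by (auto simp: E_graph_def doubleton_eq_iff)

lemma robustly_k_critical_E_graph:
  fixes X1 X2 Y1 Y2 :: "'a set"
  assumes fin: "finite X1" "finite X2" "finite Y1" "finite Y2"
    and dis: "X1 \<inter> X2 = {}" "Y1 \<inter> Y2 = {}" "(X1 \<union> X2) \<inter> (Y1 \<union> Y2) = {}"
      "z \<notin> X1 \<union> X2 \<union> Y1 \<union> Y2"
    and ne: "X1 \<noteq> {}" "X2 \<noteq> {}" "Y1 \<noteq> {}" "Y2 \<noteq> {}"
    and m: "card X1 + card X2 = m" "card Y1 + card Y2 = m" "m \<le> card X1 + card Y1"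
  shows "robustly_k_critical (Suc m) (E_graph X1 X2 Y1 Y2 z)"
proof (rule robustly_k_criticalI)
  let ?E = "E_graph X1 X2 Y1 Y2 z"
  have pos: "card X1 > 0" using fin ne by (simp add: card_gt_0_iff)
  then show "2 \<le> Suc m" using m by simp
  show simple: "simple_graph ?E"
    unfolding simple_graph_def
  proof (intro conjI ballI)
    show "finite (verts ?E)" using fin by simp
    fix e assume "e \<in> edges ?E"
    then obtain u v where "e = {u, v}" "u \<noteq> v" "u \<in> verts ?E" "v \<in> verts ?E"
      using dis by (auto simp: E_graph_def) blast+
    then show "e \<subseteq> verts ?E" "card e = 2" by auto
  qed
  show "\<exists>u. adj ?E u v" if v: "v \<in> verts ?E" for v
  proof -
    obtain x1 x2 y1 y2 where "x1 \<in> X1" "x2 \<in> X2" "y1 \<in> Y1" "y2 \<in> Y2" using ne by blast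
    note w = this
    consider "v \<in> X1" | "v \<in> X2" | "v \<in> Y1" | "v \<in> Y2" | "v = z"
      using v unfolding verts_E_graph by blast
    then show ?thesis
    proof cases
      case 1
      then have "adj ?E x2 v" unfolding edge_E_graph_iff using w dis by auto
      then show ?thesis by blast
    next
      case 2
      then have "adj ?E x1 v" unfolding edge_E_graph_iff using w dis by auto
      then show ?thesis by blast
    next
      case 3
      then have "adj ?E y2 v" unfolding edge_E_graph_iff using w dis by auto
      then show ?thesis by blast
    next
      case 4
      then have "adj ?E y1 v" unfolding edge_E_graph_iff using w dis by auto
      then show ?thesis by blast
    next
      case 5
      then have "adj ?E x1 v" unfolding edge_E_graph_iff using w by auto
      then show ?thesis by blast
    qed
  qed
  show "\<not> colorable ?E (Suc m - 1)"
  proof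
    assume "colorable ?E (Suc m - 1)"
    then obtain f where f: "f ` verts ?E \<subseteq> {1..m}" "\<And>u v. adj ?E u v \<Longrightarrow> f u \<noteq> f v"
      by (auto simp: colorable_def proper_coloring_def)
    \<comment> \<open>Each clique has \<open>m\<close> vertices and so uses all \<open>m\<close>
      colours. The colour of \<open>z\<close> must reappear in \<open>X2\<close> and in
      \<open>Y2\<close>, at two adjacent vertices.\<close>
    have onto: "f ` (A \<union> B) = {1..m}"
      if AB: "A \<union> B \<subseteq> verts ?E" "finite A" "finite B" "A \<inter> B = {}" "card A + card B = m"
        "\<And>u v. u \<in> A \<union> B \<Longrightarrow> v \<in> A \<union> B \<Longrightarrow> u \<noteq> v \<Longrightarrow> adj ?E u v" for A B
    proof -
      have "inj_on f (A \<union> B)" using f(2) AB(6) by (meson inj_onI)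
      then have "card (f ` (A \<union> B)) = card {1..m}"
        using AB by (simp add: card_image card_Un_disjoint)
      moreover have "f ` (A \<union> B) \<subseteq> {1..m}" using f(1) AB(1) by blast
      ultimately show ?thesis by (intro card_subset_eq) auto
    qed
    have "f z \<in> {1..m}" using f(1) by auto
    moreover have "f ` (X1 \<union> X2) = {1..m}"
      using fin dis m by (intro onto) (auto simp: edge_E_graph_iff)
    moreover have "f ` (Y1 \<union> Y2) = {1..m}"
      using fin dis m by (intro onto) (auto simp: edge_E_graph_iff)
    ultimately have "f z \<in> f ` (X1 \<union> X2)" "f z \<in> f ` (Y1 \<union> Y2)" by simp_all
    then obtain x y where x: "x \<in> X1 \<union> X2" "f z = f x" and y: "y \<in> Y1 \<union> Y2" "f z = f y" by blast
    have "x \<in> X2" using x f(2)[of z x] unfolding edge_E_graph_iff by blast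
    moreover have "y \<in> Y2" using y f(2)[of z y] unfolding edge_E_graph_iff by blast
    ultimately have "adj ?E x y" unfolding edge_E_graph_iff by blast
    then show False using f(2) x y by metis
  qed
  fix L :: "'a \<Rightarrow> nat set" and H
  assume fold: "fold_cover (Suc m - 1) ?E L H" and bad: "bad_cover ?E L H"
  have c: "cover ?E L H" using fold by (simp add: fold_cover_def)
  have cL: "card (L v) = m" if "v \<in> verts ?E" for v
    using fold that unfolding fold_cover_def by (metis diff_Suc_1)
  interpret matching_family "verts ?E" L "adj H" by (rule matching_family_cover[OF simple c])
  have nadj: "\<not> adj H c d" if "u \<in> verts ?E" "v \<in> verts ?E" "c \<in> L u" "d \<in> L v" "\<not> adj ?E u v"
    for u v c d using cover_adj(2)[OF c] that by blast
  have cz: "\<not> adj H c d" if "v \<in> X2 \<union> Y2" "c \<in> L z" "d \<in> L v" for v c d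
  proof (rule nadj[OF _ _ that(2,3)])
    show "\<not> adj ?E z v" unfolding edge_E_graph_iff using that(1) dis by blast
  qed (use that(1) in auto)
  have X: "half_cover (verts ?E) L (adj H) X1 X2 z m"
  proof (intro half_cover.intro half_cover_axioms.intro matching_family_axioms cL)
    show "\<not> adj H c d" if "c \<in> L z" "v \<in> X2" "d \<in> L v" for c v d
      using cz[OF _ that(1,3)] that(2) by blast
  qed (use dis ne m in auto)
  have Y: "half_cover (verts ?E) L (adj H) Y1 Y2 z m"
  proof (intro half_cover.intro half_cover_axioms.intro matching_family_axioms cL)
    show "\<not> adj H c d" if "c \<in> L z" "v \<in> Y2" "d \<in> L v" for c v d
      using cz[OF _ that(1,3)] that(2) by blast
  qed (use dis ne m in auto)
  have "E_cover (verts ?E) L (adj H) X1 X2 Y1 Y2 z m"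
  proof (rule E_cover.intro[OF X Y], rule E_cover_axioms.intro)
    show "verts ?E = insert z (X1 \<union> X2 \<union> (Y1 \<union> Y2))" by auto
    show "\<nexists>f. col (verts ?E) L f"
      using bad col_imp_cover_coloring[OF c _ matching_family_axioms] by (auto simp: bad_cover_def)
    fix x y c d assume xy: "x \<in> X1 \<union> X2" "y \<in> Y1 \<union> Y2" "\<not> (x \<in> X2 \<and> y \<in> Y2)"
      and cd: "c \<in> L x" "d \<in> L y"
    show "\<not> adj H c d"
    proof (rule nadj[OF _ _ cd])
      show "\<not> adj ?E x y" unfolding edge_E_graph_iff using xy dis by blast
    qed (use xy in auto)
  qed (use dis m in auto)
  then interpret E_cover "verts ?E" L "adj H" X1 X2 Y1 Y2 z m .
  obtain lab where lab: "\<forall>v\<in>verts ?E. bij_betw (lab v) (L v) (L z)"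
    "\<forall>u v. adj ?E u v \<longrightarrow> (\<forall>c\<in>L u. \<forall>d\<in>L v. adj H c d \<longleftrightarrow> lab u c = lab v d)"
    using ex_labelling by (elim exE conjE)
  show "canonical_cover (Suc m - 1) ?E L H"
    using lab cL finite_L by (intro canonical_coverI[OF fold simple, of "L z" lab]) auto
qed

theorem proposition1p9:
  shows "(\<forall>(k::nat) (a::nat) (b::nat) (E :: 'a graph).
            k \<ge> 3 \<and> 1 \<le> a \<and> a \<le> k - 2 \<and> 1 \<le> b \<and> b \<le> k - 2 \<and> a + b \<ge> k - 1 \<and> is_E_graph k a b E
            \<longrightarrow> robustly_critical E) \<and>
         (\<forall>(G :: 'b graph) (t::nat).
            robustly_critical G \<longrightarrow> robustly_critical (join G (complete_graph t)))"
proof (intro conjI allI impI)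
  fix k a b :: nat and E :: "'a graph"
  assume "k \<ge> 3 \<and> 1 \<le> a \<and> a \<le> k - 2 \<and> 1 \<le> b \<and> b \<le> k - 2 \<and> a + b \<ge> k - 1 \<and> is_E_graph k a b E"
  then have k: "k \<ge> 3" "1 \<le> a" "a \<le> k - 2" "1 \<le> b" "b \<le> k - 2" "a + b \<ge> k - 1"
    and "is_E_graph k a b E" by blast+
  then obtain X1 X2 Y1 Y2 z where
    fin: "finite X1" "finite X2" "finite Y1" "finite Y2" and
    dis: "X1 \<inter> X2 = {}" "X1 \<inter> Y1 = {}" "X1 \<inter> Y2 = {}" "X2 \<inter> Y1 = {}" "X2 \<inter> Y2 = {}"
      "Y1 \<inter> Y2 = {}" "z \<notin> X1 \<union> X2 \<union> Y1 \<union> Y2" and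
    cards: "card X1 = a" "card Y1 = b" "card X2 = k - 1 - a" "card Y2 = k - 1 - b" and
    E: "E = E_graph X1 X2 Y1 Y2 z"
    unfolding is_E_graph_def by (elim exE conjE)
  have "card X1 > 0" "card X2 > 0" "card Y1 > 0" "card Y2 > 0" using k cards by auto
  then have "X1 \<noteq> {}" "X2 \<noteq> {}" "Y1 \<noteq> {}" "Y2 \<noteq> {}" by fastforce+
  then have "robustly_k_critical (Suc (k - 1)) E"
    unfolding E using fin dis cards k by (intro robustly_k_critical_E_graph) auto
  then show "robustly_critical E" using k unfolding robustly_critical_def
    by (intro exI[of _ k]) simp
next
  fix G :: "'b graph" and t
  assume "robustly_critical G"
  then obtain k where "k \<ge> 1" "robustly_k_critical k G" by (auto simp: robustly_critical_def)
  then show "robustly_critical (join G (complete_graph t))"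
    using robustly_k_critical_join[of k G t] unfolding robustly_critical_def
    by (meson le_add1 order_trans)
qed

end
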